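(* Let $b\geq 2$ be an even integer, and let $G$ be a 2-connected graph of even order $n$ with minimum degree $\delta\geq 2$, where $$n\geq\max\{4b\delta,\ b\delta^{3}-b\delta-2\}.$$ If $$q(G)\geq q\bigl(K_{\delta}\vee(K_{n-(b+1)\delta}\cup b\delta K_1)\bigr),$$ then $G$ has an $H_b$-factor, unless $G=K_{\delta}\vee(K_{n-(b+1)\delta}\cup b\delta K_1)$.
   Context: All graphs are finite, undirected and simple. For a graph $G$, the order is $|V(G)|$, and $d_G(v)$ denotes the degree of the vertex $v$ in $G$; the minimum degree of $G$ is $\delta=\delta(G)$. Let $A(G)$ be the adjacency matrix and $D(G)$ the diagonal degree matrix of $G$; the signless Laplacian matrix is $Q(G)=D(G)+A(G)$, and the signless Laplacian spectral radius $q(G)$ is the largest eigenvalue of $Q(G)$. $K_m$ is the complete graph on $m$ vertices. For vertex-disjoint graphs $G_1,G_2$, $G_1\cup G_2$ is their (disjoint) union, and the join $G_1\vee G_2$ is obtained from $G_1\cup G_2$ by adding every possible edge between $V(G_1)$ and $V(G_2)$. $mK_1$ denotes the disjoint union of $m$ copies of $K_1$. Equality of graphs means equality up to isomorphism. For an even integer $b\geq 2$, an $H_b$-factor of $G$ is a spanning subgraph $F$ of $G$ such that $d_F(v)\in\{1,3,5,\ldots,b-1,b\}$ for every $v\in V(G)$ (that is, each $d_F(v)$ is either an odd integer between $1$ and $b-1$ or equal to $b$). *)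

theory Defs
  imports "Jordan_Normal_Form.Spectral_Radius"
begin

section \<open>Finite simple graphs\<close>

datatype 'a graph = Graph (verts: "'a set") (edges: "'a set set")

definition simple_graph :: "'a graph \<Rightarrow> bool" where
  "simple_graph G \<longleftrightarrow> finite (verts G) \<and> (\<forall>e\<in>edges G. e \<subseteq> verts G \<and> card e = 2)"

definition adj :: "'a graph \<Rightarrow> 'a \<Rightarrow> 'a \<Rightarrow> bool" where
  "adj G u v \<longleftrightarrow> {u, v} \<in> edges G"

definition deg :: "'a graph \<Rightarrow> 'a \<Rightarrow> nat" where
  "deg G v = card {u \<in> verts G. adj G v u}"

definition min_degree :: "'a graph \<Rightarrow> nat" where
  "min_degree G = Min (deg G ` verts G)"

definition graph_iso :: "'a graph \<Rightarrow> 'b graph \<Rightarrow> bool" where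
  "graph_iso G H \<longleftrightarrow>
     (\<exists>f. bij_betw f (verts G) (verts H) \<and>
          (\<forall>u\<in>verts G. \<forall>v\<in>verts G. adj G u v \<longleftrightarrow> adj H (f u) (f v)))"

definition spanning_subgraph :: "'a graph \<Rightarrow> 'a graph \<Rightarrow> bool" where
  "spanning_subgraph F G \<longleftrightarrow> verts F = verts G \<and> edges F \<subseteq> edges G"

definition delete_verts :: "'a graph \<Rightarrow> 'a set \<Rightarrow> 'a graph" where
  "delete_verts G X = Graph (verts G - X) {e \<in> edges G. e \<inter> X = {}}"

definition connected_graph :: "'a graph \<Rightarrow> bool" where
  "connected_graph G \<longleftrightarrow>
     verts G \<noteq> {} \<and> (\<forall>u\<in>verts G. \<forall>v\<in>verts G. (u, v) \<in> {(x, y). adj G x y}\<^sup>*)"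

definition k_connected :: "nat \<Rightarrow> 'a graph \<Rightarrow> bool" where
  "k_connected k G \<longleftrightarrow>
     k < card (verts G) \<and>
     (\<forall>X \<subseteq> verts G. card X < k \<longrightarrow> connected_graph (delete_verts G X))"


section \<open>Graph constructions\<close>

definition complete_graph :: "nat \<Rightarrow> nat graph" where
  "complete_graph m = Graph {..<m} {{u, v} | u v. u < m \<and> v < m \<and> u \<noteq> v}"

text \<open>Vertex-disjointness of the two operands is enforced by the sum type.\<close>

definition graph_union :: "'a graph \<Rightarrow> 'b graph \<Rightarrow> ('a + 'b) graph" where
  "graph_union G H = Graph (verts G <+> verts H) ((`) Inl ` edges G \<union> (`) Inr ` edges H)"

definition graph_join :: "'a graph \<Rightarrow> 'b graph \<Rightarrow> ('a + 'b) graph" where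
  "graph_join G H =
     Graph (verts G <+> verts H)
       (edges (graph_union G H) \<union> {{Inl u, Inr v} | u v. u \<in> verts G \<and> v \<in> verts H})"

definition graph_copies :: "nat \<Rightarrow> 'a graph \<Rightarrow> (nat \<times> 'a) graph" where
  "graph_copies m G = Graph ({..<m} \<times> verts G) (\<Union>i<m. (`) (Pair i) ` edges G)"


section \<open>The signless Laplacian spectral radius\<close>

text \<open>The matrices are written with respect to an arbitrary enumeration of the vertices;
  another enumeration conjugates them by a permutation matrix and so leaves the spectrum
  unchanged.\<close>

definition vertex_enum :: "'a graph \<Rightarrow> nat \<Rightarrow> 'a" where
  "vertex_enum G = (SOME f. bij_betw f {0..<card (verts G)} (verts G))"

lemma bij_betw_vertex_enum:
  assumes "simple_graph G"
  shows "bij_betw (vertex_enum G) {0..<card (verts G)} (verts G)"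
proof -
  have "\<exists>f. bij_betw f {0..<card (verts G)} (verts G)"
    using assms ex_bij_betw_nat_finite unfolding simple_graph_def by blast
  then show ?thesis
    unfolding vertex_enum_def by (rule someI_ex)
qed

definition adjacency_mat :: "'a graph \<Rightarrow> real mat" where
  "adjacency_mat G = mat (card (verts G)) (card (verts G))
     (\<lambda>(i, j). if adj G (vertex_enum G i) (vertex_enum G j) then 1 else 0)"

definition degree_mat :: "'a graph \<Rightarrow> real mat" where
  "degree_mat G = mat (card (verts G)) (card (verts G))
     (\<lambda>(i, j). if i = j then real (deg G (vertex_enum G i)) else 0)"

definition signless_laplacian :: "'a graph \<Rightarrow> real mat" where
  "signless_laplacian G = degree_mat G + adjacency_mat G"

text \<open>The matrix is real symmetric, so its real spectrum is its whole spectrum, which is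
  finite, and nonempty as soon as there is a vertex.\<close>

definition q_radius :: "'a graph \<Rightarrow> real" where
  "q_radius G = Max (spectrum (signless_laplacian G))"


section \<open>H-factors\<close>

definition has_H_factor :: "nat \<Rightarrow> 'a graph \<Rightarrow> bool" where
  "has_H_factor b G \<longleftrightarrow>
     (\<exists>F. spanning_subgraph F G \<and>
          (\<forall>v\<in>verts F. deg F v \<in> {k. odd k \<and> 1 \<le> k \<and> k \<le> b - 1} \<union> {b}))"

end

theory Submission
  imports Defs
begin

text \<open>Call a spanning subgraph feasible if its degrees are at most \<open>b\<close>, and a vertex bad in it if its
  degree is even and less than \<open>b\<close>; an \<open>H\<^sub>b\<close>-factor is a feasible subgraph without bad vertices.
  A Gallai--Edmonds argument applies to the feasible subgraphs with the fewest bad vertices: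
  let \<open>D\<close> be the set of vertices that are bad in one of them and \<open>S\<close> the set of vertices outside
  \<open>D\<close> with a neighbour in \<open>D\<close>. Deleting a vertex of \<open>S\<close> preserves \<open>D\<close> and costs \<open>b\<close> further bad
  vertices, and after deleting all of \<open>S\<close> each component has at most one bad vertex. So a connected
  graph of even order without an \<open>H\<^sub>b\<close>-factor has a nonempty set \<open>S\<close> whose deletion leaves more than
  \<open>b |S|\<close> components.

  On the spectral side, \<open>q(G) \<le> K\<close> follows from a positive weight \<open>c\<close> with \<open>Q(G) c \<le> K c\<close>
  (Collatz--Wielandt). Given such an \<open>S\<close>, one weight on \<open>S\<close>, one on a largest component and one on
  the rest give \<open>q(G) \<le> 2(n - b\<delta> - 1)\<close>, which is less than the spectral radius of the extremal
  graph, unless exactly \<open>b\<delta>\<close> vertices lie outside \<open>S\<close> and the largest component. In that case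
  \<open>G\<close> is a spanning subgraph of the extremal graph, and the equality case of Collatz--Wielandt for
  the Perron vector of the extremal graph finishes the proof.\<close>

section \<open>Graphs and edge degrees\<close>

lemma simple_graphD:
  assumes "simple_graph G"
  shows "finite (verts G)" "finite (edges G)" "e \<in> edges G \<Longrightarrow> e \<subseteq> verts G"
    "e \<in> edges G \<Longrightarrow> card e = 2"
proof -
  show 1: "finite (verts G)" "e \<in> edges G \<Longrightarrow> e \<subseteq> verts G" "e \<in> edges G \<Longrightarrow> card e = 2"
    using assms by (auto simp: simple_graph_def)
  have "edges G \<subseteq> Pow (verts G)"
    using assms by (auto simp: simple_graph_def)
  then show "finite (edges G)"
    using 1(1) by (meson finite_Pow_iff finite_subset)
qed

lemma edge_otherE:
  assumes "simple_graph G" "e \<in> edges G" "x \<in> e"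
  obtains y where "e = {x, y}" "y \<noteq> x" "y \<in> verts G" "x \<in> verts G"
proof -
  have "card e = 2" "e \<subseteq> verts G" using simple_graphD assms by blast+
  then show ?thesis
    using that assms(3) by (fastforce simp: card_2_iff)
qed

lemma adj_sym: "adj G u v \<longleftrightarrow> adj G v u"
  by (simp add: adj_def insert_commute)

lemma adjD:
  assumes "simple_graph G" "adj G u v"
  shows "u \<in> verts G" "v \<in> verts G" "u \<noteq> v"
  using assms by (auto simp: adj_def simple_graph_def)

lemma simple_graph_delete_verts: "simple_graph G \<Longrightarrow> simple_graph (delete_verts G X)"
  by (auto simp: simple_graph_def delete_verts_def)

lemma verts_delete_verts [simp]: "verts (delete_verts G X) = verts G - X"
  by (simp add: delete_verts_def)

lemma edges_delete_verts [simp]: "edges (delete_verts G X) = {e \<in> edges G. e \<inter> X = {}}"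
  by (simp add: delete_verts_def)

lemma adj_delete_verts: "adj (delete_verts G X) u v \<longleftrightarrow> adj G u v \<and> u \<notin> X \<and> v \<notin> X"
  by (auto simp: adj_def)

text \<open>Subgraphs are handled as bare edge sets, so degrees are counted by incident edges; no
  vertex set has to be carried along when edges are exchanged or vertices deleted.\<close>

definition edeg :: "'a set set \<Rightarrow> 'a \<Rightarrow> nat" where
  "edeg F v = card {e \<in> F. v \<in> e}"

lemma edeg_insert:
  assumes "finite F" "e \<notin> F"
  shows "edeg (insert e F) v = edeg F v + (if v \<in> e then 1 else 0)"
proof -
  have "{f \<in> insert e F. v \<in> f} = (if v \<in> e then insert e {f \<in> F. v \<in> f} else {f \<in> F. v \<in> f})"
    by auto
  then show ?thesis using assms by (simp add: edeg_def)
qed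

lemma edeg_remove:
  assumes "finite F" "e \<in> F"
  shows "edeg F v = edeg (F - {e}) v + (if v \<in> e then 1 else 0)"
  using edeg_insert[of "F - {e}" e v] assms by (simp add: insert_absorb)

lemma edeg_eq_deg:
  assumes "simple_graph G" "F \<subseteq> edges G" "v \<in> verts G"
  shows "edeg F v = deg (Graph (verts G) F) v"
proof -
  have "bij_betw (\<lambda>u. {v, u}) {u \<in> verts G. {v, u} \<in> F} {e \<in> F. v \<in> e}"
  proof (rule bij_betw_imageI)
    show "inj_on (\<lambda>u. {v, u}) {u \<in> verts G. {v, u} \<in> F}"
      by (auto simp: inj_on_def doubleton_eq_iff)
    have "e \<in> (\<lambda>u. {v, u}) ` {u \<in> verts G. {v, u} \<in> F}" if e: "e \<in> F" "v \<in> e" for e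
      using edge_otherE[OF assms(1), of e v] assms(2) e by blast
    then show "(\<lambda>u. {v, u}) ` {u \<in> verts G. {v, u} \<in> F} = {e \<in> F. v \<in> e}" by auto
  qed
  then show ?thesis
    by (simp add: edeg_def deg_def adj_def bij_betw_same_card)
qed

text \<open>Handshake lemma, by double counting of incidences. It gives the parity contradiction
  that makes the barrier nonempty.\<close>

lemma sum_edeg:
  assumes "simple_graph G" "F \<subseteq> edges G"
  shows "(\<Sum>v\<in>verts G. edeg F v) = 2 * card F"
proof -
  have fin: "finite (verts G)" "finite F"
    using simple_graphD[OF assms(1)] assms(2) finite_subset by blast+
  have "(\<Sum>v\<in>verts G. edeg F v) = (\<Sum>v\<in>verts G. \<Sum>e\<in>F. if v \<in> e then 1 else 0)"
    unfolding edeg_def using fin by (intro sum.cong) (auto simp: sum.If_cases Int_def)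
  also have "\<dots> = (\<Sum>e\<in>F. \<Sum>v\<in>verts G. if v \<in> e then 1 else 0)"
    by (rule sum.swap)
  also have "\<dots> = (\<Sum>e\<in>F. 2)"
  proof (rule sum.cong)
    fix e assume "e \<in> F"
    then have "e \<subseteq> verts G" "card e = 2" using assms simple_graphD by blast+
    then show "(\<Sum>v\<in>verts G. if v \<in> e then 1 else 0) = (2::nat)"
      using fin by (simp add: sum.If_cases Int_absorb1 Int_absorb2)
  qed simp
  finally show ?thesis by simp
qed

lemma edge_memD:
  assumes "simple_graph G" "{x, y} \<in> edges G"
  shows "x \<noteq> y" "x \<in> verts G" "y \<in> verts G"
  using assms by (auto simp: simple_graph_def)

section \<open>Feasible subgraphs with fewest bad vertices\<close>

locale even_bound =
  fixes b :: nat
  assumes b_even: "even b" and b_ge: "2 \<le> b"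
begin

definition bad :: "'a graph \<Rightarrow> 'a set set \<Rightarrow> 'a set" where
  "bad G F = {v \<in> verts G. even (edeg F v) \<and> edeg F v < b}"

definition feasible :: "'a graph \<Rightarrow> 'a set set \<Rightarrow> bool" where
  "feasible G F \<longleftrightarrow> F \<subseteq> edges G \<and> (\<forall>v. edeg F v \<le> b)"

definition optimal :: "'a graph \<Rightarrow> 'a set set \<Rightarrow> bool" where
  "optimal G F \<longleftrightarrow> feasible G F \<and> (\<forall>F'. feasible G F' \<longrightarrow> card (bad G F) \<le> card (bad G F'))"

text \<open>Counterpart of the Gallai-Edmonds set of vertices missed by some maximum matching, with
  "bad" in place of "missed".\<close>

definition dset :: "'a graph \<Rightarrow> 'a set" where
  "dset G = {v. \<exists>F. optimal G F \<and> v \<in> bad G F}"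

lemma bad_subset: "bad G F \<subseteq> verts G"
  by (auto simp: bad_def)

lemma finite_bad: "simple_graph G \<Longrightarrow> finite (bad G F)"
  by (rule finite_subset[OF bad_subset simple_graphD(1)])

lemma finite_feasible: "simple_graph G \<Longrightarrow> feasible G F \<Longrightarrow> finite F"
  by (rule finite_subset[of F "edges G"]) (simp_all add: feasible_def simple_graphD(2))

lemma optimal_feasible: "optimal G F \<Longrightarrow> feasible G F"
  by (simp add: optimal_def)

lemma optimal_le: "optimal G F \<Longrightarrow> feasible G F' \<Longrightarrow> card (bad G F) \<le> card (bad G F')"
  by (simp add: optimal_def)

lemma optimal_eq: "optimal G F \<Longrightarrow> optimal G F' \<Longrightarrow> card (bad G F) = card (bad G F')"
  by (simp add: optimal_def le_antisym)

lemma optimalI: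
  "feasible G F' \<Longrightarrow> optimal G F \<Longrightarrow> card (bad G F') \<le> card (bad G F) \<Longrightarrow> optimal G F'"
  unfolding optimal_def using le_trans by blast

lemma optimal_exists: "\<exists>F. optimal G F"
proof -
  have "feasible G {}" by (simp add: feasible_def edeg_def)
  then show ?thesis
    unfolding optimal_def using ex_has_least_nat[of "feasible G" "{}" "\<lambda>F. card (bad G F)"] by blast
qed

text \<open>The set on the right of the inclusion is no larger than \<open>bad G F\<close>, so
  minimality of \<open>F\<close> forces equality throughout. In particular \<open>y\<close> really
  becomes bad.\<close>

lemma exchange:
  assumes "simple_graph G" "optimal G F" "x \<in> bad G F" "feasible G F'"
    and "bad G F' \<subseteq> insert y (bad G F - {x})"
  shows "optimal G F'" "bad G F' = insert y (bad G F - {x})" "y \<notin> bad G F - {x}"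
proof -
  have fin: "finite (bad G F)" by (rule finite_bad[OF assms(1)])
  have *: "card (bad G F) = Suc (card (bad G F - {x}))"
    using assms(3) fin by (metis card_Suc_Diff1)
  have le: "card (bad G F) \<le> card (bad G F')"
    by (rule optimal_le[OF assms(2,4)])
  have up: "card (bad G F') \<le> card (insert y (bad G F - {x}))"
    using assms(5) fin by (intro card_mono) auto
  show y: "y \<notin> bad G F - {x}"
  proof
    assume "y \<in> bad G F - {x}"
    then have "insert y (bad G F - {x}) = bad G F - {x}" by blast
    then show False using le up * by simp
  qed
  have c: "card (insert y (bad G F - {x})) = card (bad G F)"
    using * y fin by auto
  show "bad G F' = insert y (bad G F - {x})"
    using assms(5) fin le c by (intro card_seteq) auto
  show "optimal G F'"
    using optimalI[OF assms(4,2)] up c by simp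
qed

section \<open>Exchange moves along one or two edges\<close>

lemma feasible_remove:
  assumes "simple_graph G" "feasible G F" "e \<in> F"
  shows "feasible G (F - {e})"
proof -
  have "edeg (F - {e}) v \<le> b" for v
    using edeg_remove[OF finite_feasible[OF assms(1,2)] assms(3), of v] assms(2)
    unfolding feasible_def by (metis le_add1 le_trans)
  then show ?thesis using assms(2) by (auto simp: feasible_def)
qed

lemma edge_in_feasible: "feasible G F \<Longrightarrow> e \<in> F \<Longrightarrow> e \<in> edges G"
  by (auto simp: feasible_def)

text \<open>Losing an edge makes the degree of \<open>x\<close> odd, so the defect passes to the
  other end \<open>y\<close>; as \<open>y\<close> must be bad afterwards, its degree in
  \<open>F\<close> was odd. Since \<open>b\<close> is even, neither end was saturated, which gives
  the last conclusion.\<close>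

lemma remove_exchange:
  assumes G: "simple_graph G" and opt: "optimal G F" and x: "x \<in> bad G F" and e: "{x, y} \<in> F"
  defines "K \<equiv> F - {{x, y}}"
  shows "optimal G K" "bad G K = insert y (bad G F - {x})" "odd (edeg F y)"
    "edeg F w = b \<Longrightarrow> edeg K w = b"
proof -
  note feas = optimal_feasible[OF opt]
  have xy: "x \<noteq> y" using edge_memD[OF G edge_in_feasible[OF feas e]] by simp
  have d: "edeg F v = edeg K v + (if v \<in> {x, y} then 1 else 0)" for v
    unfolding K_def by (rule edeg_remove[OF finite_feasible[OF G feas] e])
  have dx: "Suc (edeg K x) = edeg F x" and dy: "Suc (edeg K y) = edeg F y"
    using d[of x] d[of y] by simp_all
  have dv: "edeg K v = edeg F v" if "v \<noteq> x" "v \<noteq> y" for v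
    using d[of v] that by simp
  have fe: "feasible G K" unfolding K_def by (rule feasible_remove[OF G feas e])
  have "bad G K \<subseteq> insert y (bad G F - {x})"
  proof
    fix v assume v: "v \<in> bad G K"
    have "v \<noteq> x"
    proof
      assume "v = x"
      then have "even (edeg K x)" "even (edeg F x)" using v x by (simp_all add: bad_def)
      then show False using dx by (metis even_Suc)
    qed
    then show "v \<in> insert y (bad G F - {x})"
      using v dv[of v] by (cases "v = y") (simp_all add: bad_def)
  qed
  note ex = exchange[OF G opt x fe this]
  show "optimal G K" "bad G K = insert y (bad G F - {x})" by (fact ex)+
  then have "y \<in> bad G K" by simp
  then have "even (edeg K y)" by (simp add: bad_def)
  then show odd: "odd (edeg F y)" using dy by (metis even_Suc)
  show "edeg K w = b" if "edeg F w = b"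
  proof -
    have "w \<noteq> x" "w \<noteq> y" using that x odd b_even by (auto simp: bad_def)
    then show ?thesis using dv that by simp
  qed
qed

text \<open>Mirror image of the removal: \<open>x\<close> has room for one more edge because it is
  bad, and \<open>y\<close> by assumption.\<close>

lemma insert_exchange:
  assumes G: "simple_graph G" and opt: "optimal G F" and x: "x \<in> bad G F"
    and e: "{x, y} \<in> edges G" "{x, y} \<notin> F" and y: "edeg F y < b"
  defines "K \<equiv> insert {x, y} F"
  shows "optimal G K" "bad G K = insert y (bad G F - {x})"
    "edeg F w = b \<Longrightarrow> edeg K w = b"
proof -
  note feas = optimal_feasible[OF opt]
  have xF: "even (edeg F x)" "edeg F x < b" using x by (simp_all add: bad_def)
  have d: "edeg K v = edeg F v + (if v \<in> {x, y} then 1 else 0)" for v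
    unfolding K_def by (rule edeg_insert[OF finite_feasible[OF G feas] e(2)])
  have dx: "edeg K x = Suc (edeg F x)" using d[of x] by simp
  have dv: "edeg K v = edeg F v" if "v \<noteq> x" "v \<noteq> y" for v
    using d[of v] that by simp
  have "edeg K v \<le> b" for v
    using d[of v] xF y feas by (cases "v = x \<or> v = y") (auto simp: feasible_def)
  then have fe: "feasible G K" using feas e by (simp add: feasible_def K_def)
  have "bad G K \<subseteq> insert y (bad G F - {x})"
  proof
    fix v assume v: "v \<in> bad G K"
    then have "v \<noteq> x" using dx xF by (auto simp: bad_def)
    then show "v \<in> insert y (bad G F - {x})"
      using v dv[of v] by (cases "v = y") (simp_all add: bad_def)
  qed
  note ex = exchange[OF G opt x fe this]
  show "optimal G K" "bad G K = insert y (bad G F - {x})" by (fact ex)+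
  show "edeg K w = b" if "edeg F w = b"
  proof -
    have "w \<noteq> x" "w \<noteq> y" using that xF y by auto
    then show ?thesis using dv that by simp
  qed
qed

text \<open>When \<open>y\<close> is saturated, the new edge at \<open>y\<close> is paid for by
  dropping \<open>{y, z}\<close>: the degree of \<open>y\<close> stays \<open>b\<close> and the
  defect jumps from \<open>x\<close> to \<open>z\<close>.\<close>

lemma reroute_exchange:
  assumes G: "simple_graph G" and opt: "optimal G F" and x: "x \<in> bad G F"
    and e: "{x, y} \<in> edges G" "{x, y} \<notin> F" and y: "edeg F y = b" and z: "{y, z} \<in> F"
  defines "K \<equiv> insert {x, y} (F - {{y, z}})"
  shows "optimal G K" "bad G K = insert z (bad G F - {x})" "odd (edeg F z)"
    "edeg F w = b \<Longrightarrow> edeg K w = b"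
proof -
  note feas = optimal_feasible[OF opt]
  have fin: "finite F" by (rule finite_feasible[OF G feas])
  have xF: "even (edeg F x)" "edeg F x < b" using x by (simp_all add: bad_def)
  have xy: "x \<noteq> y" using edge_memD[OF G e(1)] by simp
  have yz: "y \<noteq> z" using edge_memD[OF G edge_in_feasible[OF feas z]] by simp
  have xz: "z \<noteq> x" using e(2) z by (auto simp: insert_commute)
  have fin': "finite (F - {{y, z}})" "{x, y} \<notin> F - {{y, z}}" using fin e by auto
  have d: "edeg K v + (if v \<in> {y, z} then 1 else 0) = edeg F v + (if v \<in> {x, y} then 1 else 0)" for v
    using edeg_insert[OF fin', of v] edeg_remove[OF fin z, of v] by (simp add: K_def)
  have dy: "edeg K y = b" using d[of y] y by simp
  have dx: "edeg K x = Suc (edeg F x)" using d[of x] xy xz by simp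
  have dz: "Suc (edeg K z) = edeg F z" using d[of z] yz xz by simp
  have dv: "edeg K v = edeg F v" if "v \<noteq> x" "v \<noteq> y" "v \<noteq> z" for v
    using d[of v] that by simp
  have bd: "edeg F v \<le> b" for v using feas by (simp add: feasible_def)
  have "edeg K v \<le> b" for v
  proof -
    consider "v = x" | "v = y" | "v = z" | "v \<noteq> x" "v \<noteq> y" "v \<noteq> z" by blast
    then show ?thesis
    proof cases
      case 3
      then show ?thesis using dz bd[of z] by simp
    qed (use dx dy dv[of v] xF bd[of v] in simp_all)
  qed
  then have fe: "feasible G K" using feas e by (auto simp: feasible_def K_def)
  have "bad G K \<subseteq> insert z (bad G F - {x})"
  proof
    fix v assume v: "v \<in> bad G K"
    then have "v \<noteq> x" using dx xF by (auto simp: bad_def)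
    moreover have "v \<noteq> y" using v dy by (auto simp: bad_def)
    ultimately show "v \<in> insert z (bad G F - {x})"
      using v dv[of v] by (cases "v = z") (simp_all add: bad_def)
  qed
  note ex = exchange[OF G opt x fe this]
  show "optimal G K" "bad G K = insert z (bad G F - {x})" by (fact ex)+
  then have "z \<in> bad G K" by simp
  then have "even (edeg K z)" by (simp add: bad_def)
  then show odd: "odd (edeg F z)" using dz by (metis even_Suc)
  show "edeg K w = b" if "edeg F w = b"
  proof -
    have "w \<noteq> x" "w \<noteq> z" using that xF odd b_even by auto
    then show ?thesis using dv dy that by (cases "w = y") simp_all
  qed
qed

lemma psubset_if_omits: "A \<subseteq> B - {x} \<Longrightarrow> x \<in> B \<Longrightarrow> A \<subset> B"
  by blast

text \<open>One step of an alternating-path argument. All three moves touch only edges of the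
  symmetric difference with \<open>F'\<close>, so the distance to \<open>F'\<close> shrinks. Applied
  to subgraphs chosen closest to \<open>F'\<close>, this gives contradictions without building whole
  paths.\<close>

lemma move_towards:
  assumes G: "simple_graph G" and opt: "optimal G F" and F': "feasible G F'"
    and x: "x \<in> bad G F" "x \<notin> bad G F'"
  obtains K y where "optimal G K" "card (sym_diff K F') < card (sym_diff F F')"
    "bad G K = insert y (bad G F - {x})" "\<And>w. edeg F w = b \<Longrightarrow> edeg K w = b"
proof -
  have feas: "feasible G F" by (rule optimal_feasible[OF opt])
  have fin: "finite F" "finite F'" using finite_feasible[OF G] feas F' by auto
  then have finD: "finite (sym_diff F F')" by simp
  have bd: "edeg F v \<le> b" "edeg F' v \<le> b" for v using feas F' by (auto simp: feasible_def)
  have sub: "F \<subseteq> edges G" "F' \<subseteq> edges G" using feas F' by (auto simp: feasible_def)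
  \<comment> \<open>Badness depends only on the degree, so some edge at \<open>x\<close> lies in
    exactly one of \<open>F\<close> and \<open>F'\<close>.\<close>
  have "edeg F x \<noteq> edeg F' x" using x by (auto simp: bad_def)
  then have "{e \<in> F. x \<in> e} \<noteq> {e \<in> F'. x \<in> e}" unfolding edeg_def by metis
  then obtain e where e: "e \<in> sym_diff F F'" "x \<in> e" by blast
  then have eG: "e \<in> edges G" using sub by blast
  obtain y where y: "e = {x, y}" "y \<noteq> x"
    using edge_otherE[OF G eG e(2)] by metis
  note eG' = eG[unfolded y(1)] and e' = e(1)[unfolded y(1)]
  consider "{x, y} \<in> F" | "{x, y} \<notin> F" "edeg F y < b" | "{x, y} \<notin> F" "edeg F y = b"
    using bd(1)[of y] by linarith
  then show ?thesis
  proof cases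
    case 1
    have "sym_diff (F - {{x, y}}) F' \<subset> sym_diff F F'" using 1 e' by blast
    then have c: "card (sym_diff (F - {{x, y}}) F') < card (sym_diff F F')"
      by (rule psubset_card_mono[OF finD])
    note ex = remove_exchange[OF G opt x(1) 1]
    show ?thesis by (rule that[OF ex(1) c ex(2) ex(4)])
  next
    case 2
    have "sym_diff (insert {x, y} F) F' \<subset> sym_diff F F'" using 2 e' by blast
    then have c: "card (sym_diff (insert {x, y} F) F') < card (sym_diff F F')"
      by (rule psubset_card_mono[OF finD])
    note ex = insert_exchange[OF G opt x(1) eG' 2]
    show ?thesis by (rule that[OF ex(1) c ex(2) ex(3)])
  next
    case 3
    have "{x, y} \<in> F'" using e' 3 by blast
    \<comment> \<open>The vertex \<open>y\<close> has degree \<open>b\<close> in \<open>F\<close>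
      and at most \<open>b\<close> in \<open>F'\<close>, and \<open>{x, y}\<close> belongs to
      \<open>F'\<close> only; so some edge of \<open>F\<close> at \<open>y\<close> is missing from
      \<open>F'\<close>.\<close>
    have "\<exists>f. f \<in> F - F' \<and> y \<in> f"
    proof (rule ccontr)
      assume "\<nexists>f. f \<in> F - F' \<and> y \<in> f"
      then have "insert {x, y} {f \<in> F. y \<in> f} \<subseteq> {f \<in> F'. y \<in> f}"
        using \<open>{x, y} \<in> F'\<close> by auto
      then have "card (insert {x, y} {f \<in> F. y \<in> f}) \<le> edeg F' y"
        unfolding edeg_def using fin by (intro card_mono) auto
      then show False using bd(2)[of y] 3 fin by (simp add: edeg_def)
    qed
    then obtain f where f: "f \<in> F" "f \<notin> F'" "y \<in> f" by blast
    obtain z where z: "f = {y, z}"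
      using edge_otherE[OF G edge_in_feasible[OF feas f(1)] f(3)] by metis
    note f' = f[unfolded z]
    have "sym_diff (insert {x, y} (F - {{y, z}})) F' \<subseteq> sym_diff F F' - {{y, z}}"
      using \<open>{x, y} \<in> F'\<close> f'(1,2) by auto
    moreover have "{y, z} \<in> sym_diff F F'" using f'(1,2) by simp
    ultimately have "sym_diff (insert {x, y} (F - {{y, z}})) F' \<subset> sym_diff F F'"
      by (rule psubset_if_omits)
    then have c: "card (sym_diff (insert {x, y} (F - {{y, z}})) F') < card (sym_diff F F')"
      by (rule psubset_card_mono[OF finD])
    note ex = reroute_exchange[OF G opt x(1) eG' 3 f'(1)]
    show ?thesis by (rule that[OF ex(1) c ex(2) ex(4)])
  qed
qed

text \<open>Removing or inserting \<open>{v, u}\<close> would put \<open>u\<close> into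
  \<open>dset G\<close>, so only rerouting through \<open>u\<close> remains possible; rerouting
  makes \<open>w\<close> bad in an optimal subgraph and forces its degree in \<open>F\<close> to be
  odd.\<close>

lemma saturated_neighbour:
  assumes G: "simple_graph G" and opt: "optimal G F" and v: "v \<in> bad G F"
    and uv: "{v, u} \<in> edges G" and u: "u \<notin> dset G"
  shows "{v, u} \<notin> F" "edeg F u = b" "{u, w} \<in> F \<Longrightarrow> w \<in> dset G \<and> odd (edeg F w)"
proof -
  note feas = optimal_feasible[OF opt]
  show nF: "{v, u} \<notin> F"
  proof
    assume "{v, u} \<in> F"
    note remove_exchange(1,2)[OF G opt v this]
    then have "u \<in> dset G" unfolding dset_def by blast
    then show False using u by simp
  qed
  show sat: "edeg F u = b"
  proof (rule ccontr)
    assume "edeg F u \<noteq> b"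
    then have "edeg F u < b" using feas by (simp add: feasible_def order.not_eq_order_implies_strict)
    note insert_exchange(1,2)[OF G opt v uv nF this]
    then have "u \<in> dset G" unfolding dset_def by blast
    then show False using u by simp
  qed
  assume "{u, w} \<in> F"
  note reroute_exchange(1,2,3)[OF G opt v uv nF sat this]
  then show "w \<in> dset G \<and> odd (edeg F w)" unfolding dset_def by blast
qed

end

section \<open>Deleting a boundary vertex\<close>

lemma edeg_star:
  assumes "finite X" "finite F" "\<And>e. e \<in> F \<Longrightarrow> u \<notin> e" "u \<notin> X"
  shows "edeg (F \<union> (\<lambda>w. {u, w}) ` X) v =
    edeg F v + (if v = u then card X else if v \<in> X then 1 else 0)"
  using assms(1,4)
proof (induction X rule: finite_induct)
  case (insert x X)
  have "{u, x} \<notin> F \<union> (\<lambda>w. {u, w}) ` X"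
    using insert.hyps insert.prems assms(3) by (auto simp: doubleton_eq_iff)
  then have "edeg (insert {u, x} (F \<union> (\<lambda>w. {u, w}) ` X)) v =
      edeg (F \<union> (\<lambda>w. {u, w}) ` X) v + (if v \<in> {u, x} then 1 else 0)"
    using edeg_insert insert.hyps assms(2) by (metis finite_UnI finite_imageI)
  then show ?case using insert by auto
qed simp

lemma edeg_avoiding: "(\<And>e. e \<in> F \<Longrightarrow> u \<notin> e) \<Longrightarrow> edeg F u = 0"
  unfolding edeg_def by (metis (mono_tags, lifting) Collect_empty_eq card.empty)

lemma star_decomposition:
  assumes "simple_graph G" "F \<subseteq> edges G"
  shows "F = {e \<in> F. u \<notin> e} \<union> (\<lambda>w. {u, w}) ` {w. {u, w} \<in> F}"
proof -
  have "e \<in> (\<lambda>w. {u, w}) ` {w. {u, w} \<in> F}" if e: "e \<in> F" "u \<in> e" for e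
  proof -
    have "e \<in> edges G" using e assms(2) by blast
    then obtain y where "e = {u, y}" using edge_otherE[OF assms(1) _ e(2)] by metis
    then show ?thesis using e by blast
  qed
  then show ?thesis by auto
qed

lemma finite_star:
  assumes "simple_graph G" "F \<subseteq> edges G"
  shows "finite {w. {u, w} \<in> F}"
proof (rule finite_subset)
  show "{w. {u, w} \<in> F} \<subseteq> verts G" using edge_memD(3)[OF assms(1)] assms(2) by blast
qed (rule simple_graphD(1)[OF assms(1)])

context even_bound
begin

text \<open>Only the neighbours \<open>W\<close> of \<open>u\<close> in \<open>F\<close> lose an
  edge. Those of odd degree end up even and below \<open>b\<close>, hence bad; if all of
  \<open>W\<close> is odd, the new bad set is known exactly.\<close>

lemma detach:
  fixes u :: 'a
  assumes G: "simple_graph G" and feas: "feasible G F"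
  defines "W \<equiv> {w. {u, w} \<in> F}" and "K \<equiv> {e \<in> F. u \<notin> e}"
  shows "feasible (delete_verts G {u}) K" "card W = edeg F u"
    "bad (delete_verts G {u}) K \<subseteq> (bad G F - {u}) \<union> W"
    "(\<And>w. w \<in> W \<Longrightarrow> odd (edeg F w)) \<Longrightarrow> bad (delete_verts G {u}) K = (bad G F - {u}) \<union> W"
proof -
  have sub: "F \<subseteq> edges G" using feas by (simp add: feasible_def)
  have fin: "finite K" using finite_feasible[OF G feas] by (simp add: K_def)
  have finW: "finite W" unfolding W_def by (rule finite_star[OF G sub])
  have uW: "u \<notin> W" unfolding W_def using edge_memD(1)[OF G] sub by blast
  have F: "F = K \<union> (\<lambda>w. {u, w}) ` W"
    unfolding K_def W_def by (rule star_decomposition[OF G sub])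
  have d: "edeg F v = edeg K v + (if v = u then card W else if v \<in> W then 1 else 0)" for v
    by (subst F, rule edeg_star[OF finW fin _ uW]) (simp add: K_def)
  have Wv: "W \<subseteq> verts G" unfolding W_def using edge_memD(3)[OF G] sub by blast
  have "edeg K u = 0" by (rule edeg_avoiding) (simp add: K_def)
  then show "card W = edeg F u" using d[of u] by simp
  have bd: "edeg F v \<le> b" for v using feas by (simp add: feasible_def)
  have "edeg K v \<le> b" for v using d[of v] bd[of v] by simp
  moreover have "K \<subseteq> edges (delete_verts G {u})" using sub by (auto simp: K_def)
  ultimately show "feasible (delete_verts G {u}) K" by (simp add: feasible_def)
  have dv: "edeg K v = edeg F v" if "v \<noteq> u" "v \<notin> W" for v using d[of v] that by simp
  show sub': "bad (delete_verts G {u}) K \<subseteq> (bad G F - {u}) \<union> W"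
    using dv by (auto simp: bad_def)
  assume odd: "\<And>w. w \<in> W \<Longrightarrow> odd (edeg F w)"
  have "w \<in> bad (delete_verts G {u}) K" if w: "w \<in> W" for w
  proof -
    have wu: "w \<noteq> u" using w uW by blast
    have "edeg F w = Suc (edeg K w)" using d[of w] w wu by simp
    then show ?thesis using odd[OF w] bd[of w] w wu Wv by (auto simp: bad_def)
  qed
  moreover have "v \<in> bad (delete_verts G {u}) K" if v: "v \<in> bad G F - {u}" for v
  proof -
    have "v \<notin> W" using v odd[of v] by (auto simp: bad_def)
    then show ?thesis using v dv[of v] by (auto simp: bad_def)
  qed
  ultimately show "bad (delete_verts G {u}) K = (bad G F - {u}) \<union> W"
    using sub' by blast
qed

text \<open>Reverse of \<open>detach\<close>: an edge to \<open>u\<close> repairs each vertex of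
  \<open>X\<close>, whose even degree becomes odd. Whether \<open>u\<close> itself is bad depends on
  \<open>card X\<close> alone, and for \<open>card X = b\<close> it is not.\<close>

lemma reattach:
  fixes u :: 'a
  assumes G: "simple_graph G" and feas: "feasible (delete_verts G {u}) F" and u: "u \<in> verts G"
    and X: "X \<subseteq> bad (delete_verts G {u}) F" "\<And>w. w \<in> X \<Longrightarrow> {u, w} \<in> edges G" "card X \<le> b"
  defines "K \<equiv> F \<union> (\<lambda>w. {u, w}) ` X"
  shows "feasible G K" "bad G K - {u} = bad (delete_verts G {u}) F - X"
    "u \<in> bad G K \<longleftrightarrow> even (card X) \<and> card X < b"
proof -
  note G' = simple_graph_delete_verts[OF G, of "{u}"]
  have sub: "F \<subseteq> edges (delete_verts G {u})" using feas by (simp add: feasible_def)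
  have av: "u \<notin> e" if "e \<in> F" for e using sub that by auto
  have finX: "finite X" by (rule finite_subset[OF X(1) finite_bad[OF G']])
  have uX: "u \<notin> X" using X(1) by (auto simp: bad_def)
  have fin: "finite F" by (rule finite_feasible[OF G' feas])
  have d: "edeg K v = edeg F v + (if v = u then card X else if v \<in> X then 1 else 0)" for v
    unfolding K_def by (rule edeg_star[OF finX fin av uX])
  have du: "edeg K u = card X" using d[of u] edeg_avoiding[OF av] by simp
  have XF: "even (edeg F w)" "edeg F w < b" if "w \<in> X" for w
    using that X(1) by (auto simp: bad_def)
  have dX: "edeg K w = Suc (edeg F w)" if "w \<in> X" for w using d[of w] that uX by auto
  have dv: "edeg K w = edeg F w" if "w \<notin> X" "w \<noteq> u" for w using d[of w] that by simp
  have "edeg K v \<le> b" for v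
  proof -
    consider "v = u" | "v \<in> X" | "v \<notin> X" "v \<noteq> u" by blast
    then show ?thesis
    proof cases
      case 1 then show ?thesis using du X(3) by simp
    next
      case 2 then show ?thesis using dX[of v] XF(2)[of v] by simp
    next
      case 3 then show ?thesis using dv[of v] feas by (simp add: feasible_def)
    qed
  qed
  moreover have "K \<subseteq> edges G" using sub X(2) by (auto simp: K_def)
  ultimately show "feasible G K" by (simp add: feasible_def)
  show "u \<in> bad G K \<longleftrightarrow> even (card X) \<and> card X < b"
    using u du by (simp add: bad_def)
  show "bad G K - {u} = bad (delete_verts G {u}) F - X"
  proof (rule Set.set_eqI)
    fix v
    show "v \<in> bad G K - {u} \<longleftrightarrow> v \<in> bad (delete_verts G {u}) F - X"
    proof (cases "v \<in> X")
      case True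
      then show ?thesis using dX[of v] XF(1)[of v] by (simp add: bad_def)
    next
      case False
      then show ?thesis using dv[of v] by (auto simp: bad_def)
    qed
  qed
qed

text \<open>Given an optimal \<open>F'\<close> with bad vertex \<open>v\<close>, the graph \<open>F' - u\<close> has \<open>b + 1\<close> bad vertices adjacent
  to \<open>u\<close>. By the choice of \<open>F0\<close> as close as possible to \<open>F' - u\<close>, enough of them remain bad in
  \<open>F0\<close>, and joining these to \<open>u\<close> turns \<open>F0\<close> into a subgraph of \<open>G\<close> that is too good.\<close>

lemma delete_barrier_vertex:
  assumes G: "simple_graph G" and u: "u \<notin> dset G" and v: "v \<in> dset G" "{v, u} \<in> edges G"
    and F: "optimal G F" and F1: "optimal (delete_verts G {u}) F1"
  shows "card (bad (delete_verts G {u}) F1) = card (bad G F) + b"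
    and "dset (delete_verts G {u}) = dset G"
proof -
  let ?H = "delete_verts G {u}"
  note H = simple_graph_delete_verts[OF G, of "{u}"]
  define k where "k = card (bad G F)"
  have k: "card (bad G F') = k" if "optimal G F'" for F'
    using optimal_eq[OF F that] by (simp add: k_def)
  have uV: "u \<in> verts G" using edge_memD(3)[OF G v(2)] .
  obtain F' where F': "optimal G F'" "v \<in> bad G F'" using v(1) unfolding dset_def by blast
  have kpos: "0 < k"
    using k[OF F'(1)] F'(2) finite_bad[OF G, of F'] by (metis card_gt_0_iff empty_iff)
  note sat = saturated_neighbour[OF G F' v(2) u]
  define W where "W = {w. {u, w} \<in> F'}"
  define K where "K = {e \<in> F'. u \<notin> e}"
  have W: "W \<subseteq> dset G" "\<And>w. w \<in> W \<Longrightarrow> odd (edeg F' w)" using sat(3) by (auto simp: W_def)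
  note det = detach[OF G optimal_feasible[OF F'(1)], of u, folded W_def K_def]
  have unb: "u \<notin> bad G M" if "optimal G M" for M using that u unfolding dset_def by blast
  have feasK: "feasible ?H K" by (rule det(1))
  have badK: "bad ?H K = bad G F' \<union> W" using det(4)[OF W(2)] unb[OF F'(1)] by simp
  have cW: "card W = b" using det(2) sat(2) by simp
  have finW: "finite W" using cW b_ge card.infinite by fastforce
  have "bad G F' \<inter> W = {}" using W(2) by (auto simp: bad_def)
  then have cK: "card (bad ?H K) = k + b"
    using badK k[OF F'(1)] cW finW finite_bad[OF G] by (simp add: card_Un_disjoint)
  \<comment> \<open>\<open>T\<close> has one vertex more than \<open>u\<close> can be joined to;
    both halves of the proof use this surplus.\<close>
  define T where "T = insert v W"
  have "v \<notin> W" using sat(1) by (auto simp: W_def insert_commute)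
  then have cT: "card T = Suc b" using cW finW by (simp add: T_def)
  have finT: "finite T" using finW by (simp add: T_def)
  have TK: "T \<subseteq> bad ?H K" using badK F'(2) by (auto simp: T_def)
  have TD: "T \<subseteq> dset G" using W(1) v(1) by (simp add: T_def)
  have Tu: "{u, w} \<in> edges G" if "w \<in> T" for w
    using that v(2) edge_in_feasible[OF optimal_feasible[OF F'(1)]]
    by (auto simp: T_def W_def insert_commute)
  have finb: "finite (bad ?H M)" for M by (rule finite_bad[OF H])

  have lower: "k + b \<le> card (bad ?H F1)"
  proof (rule ccontr)
    assume "\<not> k + b \<le> card (bad ?H F1)"
    obtain F0 where F0: "optimal ?H F0"
      and least: "\<And>M. optimal ?H M \<Longrightarrow> card (sym_diff F0 K) \<le> card (sym_diff M K)"
      using ex_has_least_nat[of "optimal ?H" F1 "\<lambda>M. card (sym_diff M K)"] F1 by blast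
    have c0: "card (bad ?H F0) < k + b"
      using optimal_eq[OF F0 F1] \<open>\<not> k + b \<le> card (bad ?H F1)\<close> by simp
    have sub: "bad ?H F0 \<subseteq> bad ?H K"
    proof
      fix x assume x: "x \<in> bad ?H F0"
      show "x \<in> bad ?H K"
      proof (rule ccontr)
        assume "x \<notin> bad ?H K"
        then obtain M where "optimal ?H M" "card (sym_diff M K) < card (sym_diff F0 K)"
          using move_towards[OF H F0 feasK x] by metis
        then show False using least[of M] by simp
      qed
    qed
    define X where "X = T \<inter> bad ?H F0"
    have finX: "finite X" using finT by (simp add: X_def)
    obtain Y where Y: "Y \<subseteq> X" "card Y = min (card X) b"
      using obtain_subset_with_card_n[of "min (card X) b" X] by auto
    have finY: "finite Y" using Y(1) finX by (rule finite_subset)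
    \<comment> \<open>Either \<open>u\<close> can absorb \<open>b\<close> bad vertices, or it
      absorbs all of \<open>X\<close>; in the latter case the \<open>b + 1 - card X\<close> vertices
      of \<open>T - X\<close> are bad in \<open>K\<close> but not in \<open>F0\<close>.\<close>
    have small: "card (bad ?H F0) < k + card Y"
    proof (cases "b \<le> card X")
      case True
      then show ?thesis using Y c0 by simp
    next
      case False
      have "bad ?H F0 \<subseteq> bad ?H K - (T - X)" using sub by (auto simp: X_def)
      then have "card (bad ?H F0) \<le> card (bad ?H K - (T - X))"
        by (rule card_mono[OF finite_Diff[OF finb]])
      also have "\<dots> = (k + b) - card (T - X)"
        using TK finT cK by (subst card_Diff_subset) auto
      also have "card (T - X) = Suc b - card X"
        using cT finX by (subst card_Diff_subset) (auto simp: X_def)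
      finally show ?thesis using False Y(2) kpos by simp
    qed
    have Yb: "Y \<subseteq> bad ?H F0" and YT: "Y \<subseteq> T" using Y(1) by (auto simp: X_def)
    define M where "M = F0 \<union> (\<lambda>w. {u, w}) ` Y"
    have "card Y \<le> b" using Y(2) by simp
    note re = reattach[OF G optimal_feasible[OF F0] uV Yb Tu[OF subsetD[OF YT]] this, folded M_def]
    have "card (bad G M - {u}) = card (bad ?H F0) - card Y"
      using re(2) card_Diff_subset[OF finY Yb] by simp
    then have lt: "card (bad G M - {u}) < k"
      using small card_mono[OF finb Yb] by linarith
    have le: "k \<le> card (bad G M)" using optimal_le[OF F re(1)] by (simp add: k_def)
    show False
    \<comment> \<open>If \<open>u\<close> is bad in \<open>M\<close>, then \<open>M\<close> is still
      optimal, contrary to \<open>u\<close> lying outside \<open>dset G\<close>; otherwise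
      \<open>M\<close> has fewer bad vertices than \<open>F\<close>.\<close>
    proof (cases "u \<in> bad G M")
      case True
      then have "card (bad G M) \<le> k" 
        using lt card_Suc_Diff1[OF finite_bad[OF G] True] by linarith
      then have "optimal G M" using optimalI[OF re(1) F] by (simp add: k_def)
      then show False using unb True by blast
    next
      case False
      then show False using lt le by simp
    qed
  qed
  have optK: "optimal ?H K"
    by (rule optimalI[OF feasK F1]) (use cK lower in simp)
  show "card (bad ?H F1) = card (bad G F) + b"
    using optimal_eq[OF F1 optK] cK by (simp add: k_def)
  have cH: "card (bad ?H M) = k + b" if "optimal ?H M" for M
    using optimal_eq[OF that optK] cK by simp

  show "dset ?H = dset G"
  proof
    \<comment> \<open>Detaching \<open>u\<close> from an optimal \<open>M\<close> adds at most
      \<open>b\<close> bad vertices. The lower bound shows that it adds exactly that many, so every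
      bad vertex of \<open>M\<close> stays bad.\<close>
    show "dset G \<subseteq> dset ?H"
    proof
      fix x assume "x \<in> dset G"
      then obtain M where M: "optimal G M" "x \<in> bad G M" unfolding dset_def by blast
      define B where "B = {w. {u, w} \<in> M}"
      define M' where "M' = {e \<in> M. u \<notin> e}"
      note det = detach[OF G optimal_feasible[OF M(1)], of u, folded B_def M'_def]
      have finB: "finite B" unfolding B_def
        by (rule finite_star[OF G]) (use optimal_feasible[OF M(1)] in \<open>simp add: feasible_def\<close>)
      have sub: "bad ?H M' \<subseteq> bad G M \<union> B" using det(3) unb[OF M(1)] by simp
      have "card (bad G M \<union> B) \<le> k + card B" using card_Un_le[of "bad G M" B] k[OF M(1)] by simp
      also have "\<dots> \<le> k + b" using det(2) optimal_feasible[OF M(1)] by (simp add: feasible_def)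
      finally have up: "card (bad G M \<union> B) \<le> k + b" .
      have fin: "finite (bad G M \<union> B)" using finB finite_bad[OF G] by simp
      have le: "k + b \<le> card (bad ?H M')"
        using optimal_le[OF optK det(1)] cK by simp
      have eq: "bad ?H M' = bad G M \<union> B"
        by (rule card_seteq[OF fin sub]) (use up le in simp)
      have "optimal ?H M'"
        by (rule optimalI[OF det(1) optK]) (use up eq cK in simp)
      then show "x \<in> dset ?H" using eq M(2) unfolding dset_def by blast
    qed
    \<comment> \<open>Conversely, joining \<open>u\<close> to \<open>b\<close> vertices of
      \<open>T\<close> that are bad in \<open>F0\<close> yields an optimal subgraph of
      \<open>G\<close>. It leaves \<open>x\<close> bad, because \<open>T\<close> lies inside
      \<open>dset G\<close> and \<open>x\<close> does not.\<close>
    show "dset ?H \<subseteq> dset G"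
    proof (rule subsetI, rule ccontr)
      fix x assume x: "x \<in> dset ?H" and xG: "x \<notin> dset G"
      let ?P = "\<lambda>M. optimal ?H M \<and> x \<in> bad ?H M"
      obtain M0 where "?P M0" using x unfolding dset_def by blast
      then obtain F0 where F0: "optimal ?H F0" "x \<in> bad ?H F0"
        and least: "\<And>M. ?P M \<Longrightarrow> card (sym_diff F0 K) \<le> card (sym_diff M K)"
        using ex_has_least_nat[of ?P M0 "\<lambda>M. card (sym_diff M K)"] by blast
      have KD: "bad ?H K \<subseteq> dset G" using badK W(1) F'(1) unfolding dset_def by blast
      have sub: "bad ?H F0 - {x} \<subseteq> bad ?H K"
      proof
        fix z assume z: "z \<in> bad ?H F0 - {x}"
        show "z \<in> bad ?H K"
        proof (rule ccontr)
          assume nz: "z \<notin> bad ?H K"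
          have z': "z \<in> bad ?H F0" using z by blast
          obtain M y where M: "optimal ?H M" "card (sym_diff M K) < card (sym_diff F0 K)"
            "bad ?H M = insert y (bad ?H F0 - {z})"
            by (rule move_towards[OF H F0(1) feasK z' nz])
          then have "?P M" using F0(2) z by auto
          then show False using least[of M] M(2) by simp
        qed
      qed
      define X where "X = T \<inter> bad ?H F0"
      have finX: "finite X" using finT by (simp add: X_def)
      \<comment> \<open>\<open>bad ?H K\<close> has only one element more than its subset
        \<open>bad ?H F0 - {x}\<close>, so at most one vertex of \<open>T\<close> is not bad in
        \<open>F0\<close>.\<close>
      have "b \<le> card X"
      proof -
        have "card (bad ?H F0 - {x}) = k + b - 1"
          using cH[OF F0(1)] F0(2) by (simp add: card_Diff_singleton)
        moreover have "card (bad ?H K - (bad ?H F0 - {x})) =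
            card (bad ?H K) - card (bad ?H F0 - {x})"
          by (rule card_Diff_subset[OF finite_Diff[OF finb] sub])
        ultimately have 1: "card (bad ?H K - (bad ?H F0 - {x})) \<le> 1" using cK by simp
        have "T - X \<subseteq> bad ?H K - (bad ?H F0 - {x})" using TK by (auto simp: X_def)
        then have "card (T - X) \<le> 1" using 1 card_mono[OF finite_Diff[OF finb]] le_trans by blast
        moreover have "card (T - X) = Suc b - card X"
          using cT finX by (subst card_Diff_subset) (auto simp: X_def)
        ultimately show ?thesis by simp
      qed
      then obtain Y where Y: "Y \<subseteq> X" "card Y = b"
        using obtain_subset_with_card_n by metis
      have finY: "finite Y" using Y(1) finX by (rule finite_subset)
      have Yb: "Y \<subseteq> bad ?H F0" and YT: "Y \<subseteq> T" using Y(1) by (auto simp: X_def)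
      have xY: "x \<notin> Y" using YT TD xG by blast
      define M where "M = F0 \<union> (\<lambda>w. {u, w}) ` Y"
      have Yle: "card Y \<le> b" using Y(2) by simp
      note re = reattach[OF G optimal_feasible[OF F0(1)] uV Yb Tu[OF subsetD[OF YT]] Yle,
          folded M_def]
      have "u \<notin> bad G M" using re(3) Y(2) by simp
      then have eq: "bad G M = bad ?H F0 - Y" using re(2) by simp
      have "card (bad G M) = k + b - b"
        unfolding eq using card_Diff_subset[OF finY Yb] cH[OF F0(1)] Y(2) by simp
      then have "optimal G M" using optimalI[OF re(1) F] by (simp add: k_def)
      moreover have "x \<in> bad G M" using eq F0(2) xY by blast
      ultimately show False using xG unfolding dset_def by blast
    qed
  qed
qed

end

section \<open>The barrier of a graph without a factor\<close>

lemma delete_verts_empty: "delete_verts G {} = G"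
  by (cases G) (simp add: delete_verts_def)

lemma delete_verts_delete_verts: "delete_verts (delete_verts G X) Y = delete_verts G (X \<union> Y)"
  by (auto simp: delete_verts_def)

lemma card_Diff_eq:
  assumes "finite A" "finite B" "card A = card B"
  shows "card (A - B) = card (B - A)"
  using assms by (simp add: card_Diff_subset_Int Int_commute)

context even_bound
begin

text \<open>Counterpart of the separating set in the Gallai-Edmonds decomposition; it will serve as
  the barrier.\<close>

definition boundary :: "'a graph \<Rightarrow> 'a set" where
  "boundary G = {u. u \<notin> dset G \<and> (\<exists>v\<in>dset G. {v, u} \<in> edges G)}"

lemma boundary_subset: "simple_graph G \<Longrightarrow> boundary G \<subseteq> verts G"
  using edge_memD(3) by (fastforce simp: boundary_def)

text \<open>Deleting one boundary vertex leaves \<open>dset\<close> unchanged and therefore takes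
  only that vertex out of the boundary, so the single-vertex result can be iterated.\<close>

lemma delete_boundary:
  assumes "simple_graph G" "optimal G F" "optimal (delete_verts G (boundary G)) F1"
  shows "card (bad (delete_verts G (boundary G)) F1) = card (bad G F) + b * card (boundary G) \<and>
    dset (delete_verts G (boundary G)) = dset G"
  using assms
proof (induction "card (boundary G)" arbitrary: G F)
  case 0
  have "finite (boundary G)"
    by (rule finite_subset[OF boundary_subset[OF 0(2)] simple_graphD(1)[OF 0(2)]])
  then have "boundary G = {}" using 0(1) by simp
  then show ?case using 0(3,4) optimal_eq[of G F1 F] by (simp add: delete_verts_empty)
next
  case (Suc m)
  note G = Suc.prems(1)
  have "boundary G \<noteq> {}" using Suc.hyps(2) by auto
  then obtain u v where u: "u \<in> boundary G" "u \<notin> dset G" and v: "v \<in> dset G" "{v, u} \<in> edges G"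
    by (auto simp: boundary_def)
  let ?H = "delete_verts G {u}"
  obtain F2 where F2: "optimal ?H F2" using optimal_exists by blast
  note del = delete_barrier_vertex[OF G u(2) v Suc.prems(2) F2]
  have bH: "boundary ?H = boundary G - {u}"
    using del(2) u(2) by (auto simp: boundary_def)
  then have m: "m = card (boundary ?H)" using Suc.hyps(2) u(1) by simp
  have eq: "delete_verts ?H (boundary ?H) = delete_verts G (boundary G)"
    using bH u(1) by (simp add: delete_verts_delete_verts insert_absorb)
  have "optimal (delete_verts ?H (boundary ?H)) F1" using Suc.prems(3) eq by simp
  from Suc.hyps(1)[OF m simple_graph_delete_verts[OF G] F2 this]
  show ?case using del m Suc.hyps(2)[symmetric] by (simp add: eq algebra_simps)
qed

text \<open>The analogue of Gallai's lemma: when \<open>t\<close> is the vertex after \<open>u\<close> on a shortest path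
  between two bad vertices \<open>u\<close> and \<open>v\<close> of \<open>F\<close>, an optimal \<open>F'\<close> in which \<open>t\<close> is bad, chosen
  as close as possible to \<open>F\<close>, can still be moved towards \<open>F\<close>.\<close>

lemma bad_unconnected:
  assumes G: "simple_graph G"
    and closed: "\<And>x y. x \<in> dset G \<Longrightarrow> {x, y} \<in> edges G \<Longrightarrow> y \<in> dset G"
    and "optimal G F" "u \<in> bad G F" "v \<in> bad G F" "u \<noteq> v"
  shows "(u, v) \<notin> {(x, y). adj G x y}\<^sup>*"
proof -
  let ?r = "{(x, y). adj G x y}"
  have "(u, v) \<notin> ?r ^^ d" for d
    using assms(3-6)
  proof (induction d arbitrary: F u v rule: less_induct)
    case (less d)
    note F = less.prems(1)
    show ?case
    proof
      assume uv: "(u, v) \<in> ?r ^^ d"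
      have "d \<noteq> 0" using uv less.prems(4) by (cases d) auto
      then obtain d' where d: "d = Suc d'" by (cases d) auto
      obtain t where t: "adj G u t" "(t, v) \<in> ?r ^^ d'"
        using relpow_Suc_D2[OF uv[unfolded d]] by auto
      then have ut: "{u, t} \<in> edges G" by (simp add: adj_def)
      have un: "u \<noteq> t" using edge_memD(1)[OF G ut] .
      have "u \<in> dset G" using F less.prems(2) unfolding dset_def by blast
      then have "t \<in> dset G" using closed ut by blast
      show False
      proof (cases "t = v")
        case True
        \<comment> \<open>Two adjacent bad vertices: removing or inserting their common edge would
          repair both.\<close>
        show False
        proof (cases "{u, t} \<in> F")
          case True
          from remove_exchange(3)[OF G F less.prems(2) True]
          show False using less.prems(3) \<open>t = v\<close> by (simp add: bad_def)
        next
          case False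
          have tb: "edeg F t < b" using less.prems(3) \<open>t = v\<close> by (simp add: bad_def)
          note insert_exchange(1,2)[OF G F less.prems(2) ut False tb]
          then have "card (insert t (bad G F - {u})) = card (bad G F)" using optimal_eq F by metis
          moreover have "insert t (bad G F - {u}) = bad G F - {u}"
            using less.prems(3) un \<open>t = v\<close> by blast
          moreover have "card (bad G F - {u}) < card (bad G F)"
            by (rule card_Diff1_less[OF finite_bad[OF G] less.prems(2)])
          ultimately show False by simp
        qed
      next
        case tv: False
        then have "d' \<noteq> 0" using t(2) by (cases d') auto
        let ?P = "\<lambda>M. optimal G M \<and> t \<in> bad G M"
        obtain M0 where "?P M0" using \<open>t \<in> dset G\<close> unfolding dset_def by blast
        then obtain M where M: "optimal G M" "t \<in> bad G M"
          and least: "\<And>N. ?P N \<Longrightarrow> card (sym_diff M F) \<le> card (sym_diff N F)"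
          using ex_has_least_nat[of ?P M0 "\<lambda>N. card (sym_diff N F)"] by blast
        \<comment> \<open>The induction hypothesis at the distances \<open>1\<close> and
          \<open>d'\<close>, both below \<open>d\<close>, shows that neither \<open>u\<close> nor
          \<open>v\<close> can be bad together with \<open>t\<close>.\<close>
        have "(u, t) \<in> ?r ^^ 1" using t(1) by auto
        then have "u \<notin> bad G M"
          using less.IH[of 1 M u t] M un d \<open>d' \<noteq> 0\<close> by auto
        moreover have "v \<notin> bad G M"
          using less.IH[of d' M t v] M t(2) tv d by auto
        ultimately have "{u, v} \<subseteq> bad G F - bad G M" using less.prems(2,3) by blast
        then have "card {u, v} \<le> card (bad G F - bad G M)"
          by (rule card_mono[OF finite_Diff[OF finite_bad[OF G]]])
        then have "2 \<le> card (bad G F - bad G M)" using less.prems(4) by simp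
        \<comment> \<open>Optimal subgraphs have equally many bad vertices, so \<open>M\<close> also
          has two that are not bad in \<open>F\<close>. One of them differs from \<open>t\<close>,
          and moving it keeps \<open>t\<close> bad.\<close>
        also have "\<dots> = card (bad G M - bad G F)"
          by (rule card_Diff_eq[OF finite_bad[OF G] finite_bad[OF G] optimal_eq[OF F M(1)]])
        finally have "\<not> bad G M - bad G F \<subseteq> {t}"
          using card_mono[of "{t}" "bad G M - bad G F"] by auto
        then obtain x where x: "x \<in> bad G M" "x \<notin> bad G F" "x \<noteq> t" by blast
        obtain N y where N: "optimal G N" "card (sym_diff N F) < card (sym_diff M F)"
          "bad G N = insert y (bad G M - {x})"
          by (rule move_towards[OF G M(1) optimal_feasible[OF F] x(1,2)])
        then have "?P N" using M(2) x(3) by auto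
        then show False using least[of N] N(2) by simp
      qed
    qed
  qed
  then show ?thesis by (simp add: rtrancl_power)
qed

text \<open>All optimal subgraphs have a single bad vertex here, so \<open>y\<close> is the only one
  of \<open>M\<close>. Moves keep saturated vertices saturated; hence an optimal subgraph saturated
  at \<open>y\<close> and closest to \<open>M\<close> could be moved closer still.\<close>

lemma no_saturated_vertex:
  assumes G: "simple_graph G" and opt: "optimal G F" and bad: "bad G F = {r}" and y: "y \<in> dset G"
  shows "edeg F y \<noteq> b"
proof
  assume sat: "edeg F y = b"
  obtain M where M: "optimal G M" "y \<in> bad G M" using y unfolding dset_def by blast
  have one: "card (bad G N) = 1" if "optimal G N" for N using optimal_eq[OF opt that] bad by simp
  have badM: "bad G M = {y}" using one[OF M(1)] M(2) by (metis card_1_singletonE singletonD)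
  let ?P = "\<lambda>N. optimal G N \<and> edeg N y = b"
  obtain N where N: "optimal G N" "edeg N y = b"
    and least: "\<And>K. ?P K \<Longrightarrow> card (sym_diff N M) \<le> card (sym_diff K M)"
    using ex_has_least_nat[of ?P F "\<lambda>N. card (sym_diff N M)"] opt sat by blast
  obtain x where x: "bad G N = {x}" using one[OF N(1)] by (metis card_1_singletonE)
  have "x \<noteq> y" using x N(2) by (auto simp: bad_def)
  then have nx: "x \<notin> bad G M" using badM by simp
  have "x \<in> bad G N" using x by simp
  then obtain K z where K: "optimal G K" "card (sym_diff K M) < card (sym_diff N M)"
    "bad G K = insert z (bad G N - {x})" "\<And>w. edeg N w = b \<Longrightarrow> edeg K w = b"
    using move_towards[OF G N(1) optimal_feasible[OF M(1)] _ nx] by metis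
  then show False using least[of K] N(2) by simp
qed

text \<open>\<open>S\<close> is the boundary and \<open>T\<close> the bad set of an optimal subgraph
  of \<open>G - S\<close>. Each deleted vertex costs \<open>b\<close> bad vertices on top of at
  least one, and in \<open>G - S\<close> the set \<open>dset\<close> is closed under adjacency, so
  \<open>bad_unconnected\<close> separates \<open>T\<close>.\<close>

theorem H_factor_or_barrier:
  assumes G: "simple_graph G" and conn: "connected_graph G" and ev: "even (card (verts G))"
    and no: "\<not> has_H_factor b G"
  obtains S T where "S \<subseteq> verts G" "S \<noteq> {}" "T \<subseteq> verts G - S" "b * card S < card T"
    "\<And>x y. x \<in> T \<Longrightarrow> y \<in> T \<Longrightarrow> x \<noteq> y \<Longrightarrow> (x, y) \<notin> {(x, y). adj (delete_verts G S) x y}\<^sup>*"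
proof -
  obtain F where F: "optimal G F" using optimal_exists by blast
  note feas = optimal_feasible[OF F]
  have sub: "F \<subseteq> edges G" using feas by (simp add: feasible_def)
  have ne: "bad G F \<noteq> {}"
  proof
    assume none: "bad G F = {}"
    have "deg (Graph (verts G) F) v \<in> {k. odd k \<and> 1 \<le> k \<and> k \<le> b - 1} \<union> {b}"
      if v: "v \<in> verts G" for v
    proof -
      have le: "edeg F v \<le> b" using feas by (simp add: feasible_def)
      have nb: "\<not> (even (edeg F v) \<and> edeg F v < b)" using none v by (auto simp: bad_def)
      show ?thesis
      proof (cases "edeg F v = b")
        case True
        then show ?thesis using edeg_eq_deg[OF G sub v] by simp
      next
        case False
        then have "odd (edeg F v)" "edeg F v \<le> b - 1" using le nb by auto
        then show ?thesis using edeg_eq_deg[OF G sub v] odd_pos by fastforce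
      qed
    qed
    then have "has_H_factor b G"
      unfolding has_H_factor_def spanning_subgraph_def
      using sub by (intro exI[of _ "Graph (verts G) F"]) simp
    then show False using no by simp
  qed
  then have pos: "0 < card (bad G F)" using finite_bad[OF G] by (simp add: card_gt_0_iff)
  let ?S = "boundary G"
  let ?H = "delete_verts G ?S"
  note H = simple_graph_delete_verts[OF G, of ?S]
  obtain F1 where F1: "optimal ?H F1" using optimal_exists by blast
  note del = delete_boundary[OF G F F1]
  have closed: "y \<in> dset ?H" if "x \<in> dset ?H" "{x, y} \<in> edges ?H" for x y
    using that del by (auto simp: boundary_def)
  have unc: "(x, y) \<notin> {(x, y). adj ?H x y}\<^sup>*"
    if "x \<in> bad ?H F1" "y \<in> bad ?H F1" "x \<noteq> y" for x y
    by (rule bad_unconnected[OF H _ F1 that]) (rule closed)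
  \<comment> \<open>With empty boundary, connectedness makes \<open>dset G\<close> all of
    \<open>verts G\<close>. Then there is one bad vertex \<open>r\<close>, no other vertex is
    saturated, and all other degrees are odd; as the order is even, the degree sum would be
    odd.\<close>
  have "?S \<noteq> {}"
  proof
    assume S: "?S = {}"
    then have HG: "?H = G" by (simp add: delete_verts_empty)
    have all: "x \<in> dset G" if "x \<in> verts G" for x
    proof -
      obtain r where r: "r \<in> bad G F" using ne by blast
      then have rD: "r \<in> dset G" using F unfolding dset_def by blast
      have "(r, x) \<in> {(x, y). adj G x y}\<^sup>*"
        using conn that r bad_subset[of G F] unfolding connected_graph_def by blast
      then show ?thesis
      proof (induction rule: rtrancl_induct)
        case (step y z)
        then show ?case using closed[unfolded HG] by (simp add: adj_def)
      qed (rule rD)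
    qed
    obtain r where r: "r \<in> bad G F" using ne by blast
    have "bad G F = {r}"
    proof -
      have "x = r" if x: "x \<in> bad G F" for x
      proof (rule ccontr)
        assume "x \<noteq> r"
        then have "(x, r) \<notin> {(x, y). adj G x y}\<^sup>*"
          by (intro bad_unconnected[OF G _ F x r \<open>x \<noteq> r\<close>]) (rule closed[unfolded HG])
        moreover have "x \<in> verts G" "r \<in> verts G" using bad_subset[of G F] x r by auto
        ultimately show False using conn unfolding connected_graph_def by blast
      qed
      then show ?thesis using r by blast
    qed
    note badF = this
    have odd: "odd (edeg F x)" if "x \<in> verts G - {r}" for x
    proof -
      have "edeg F x \<noteq> b" using no_saturated_vertex[OF G F badF all] that by blast
      moreover have "edeg F x \<le> b" using feas by (simp add: feasible_def)
      moreover have "x \<notin> bad G F" using badF that by simp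
      ultimately show ?thesis using that by (auto simp: bad_def)
    qed
    have fin: "finite (verts G)" by (rule simple_graphD(1)[OF G])
    have rV: "r \<in> verts G" using bad_subset[of G F] r by blast
    have "(\<Sum>x\<in>verts G. edeg F x) = edeg F r + (\<Sum>x\<in>verts G - {r}. edeg F x)"
      by (rule sum.remove[OF fin rV])
    moreover have "odd (\<Sum>x\<in>verts G - {r}. edeg F x)"
    proof -
      have "{x \<in> verts G - {r}. odd (edeg F x)} = verts G - {r}" using odd by blast
      moreover have "odd (card (verts G - {r}))"
        using card_Suc_Diff1[OF fin rV] ev by (metis even_Suc)
      ultimately show ?thesis using fin by (simp add: even_sum_iff)
    qed
    moreover have "even (edeg F r)" using r by (simp add: bad_def)
    ultimately show False using sum_edeg[OF G sub] by (metis dvd_triv_left even_add)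
  qed
  moreover have "bad ?H F1 \<subseteq> verts G - ?S" using bad_subset[of ?H F1] by simp
  moreover have "b * card ?S < card (bad ?H F1)" using del pos by simp
  ultimately show ?thesis
    using that[OF boundary_subset[OF G]] unc by blast
qed

end

section \<open>Bounds for the signless Laplacian spectral radius\<close>

definition nbrs :: "'a graph \<Rightarrow> 'a \<Rightarrow> 'a set" where
  "nbrs G v = {u \<in> verts G. adj G v u}"

text \<open>The action of the signless Laplacian on functions on the vertices.\<close>

definition qop :: "'a graph \<Rightarrow> ('a \<Rightarrow> 'b::comm_monoid_add) \<Rightarrow> 'a \<Rightarrow> 'b" where
  "qop G x v = (\<Sum>u\<in>nbrs G v. x v + x u)"

lemma finite_nbrs: "simple_graph G \<Longrightarrow> finite (nbrs G v)"
  unfolding nbrs_def by (rule finite_subset[OF _ simple_graphD(1)]) auto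

lemma signless_laplacian_carrier:
  "signless_laplacian G \<in> carrier_mat (card (verts G)) (card (verts G))"
  by (simp add: signless_laplacian_def degree_mat_def adjacency_mat_def)

lemma signless_laplacian_mult_vec:
  fixes x :: "'a \<Rightarrow> 'b::{real_algebra_1,field}"
  assumes G: "simple_graph G" and i: "i < card (verts G)"
  shows "(map_mat of_real (signless_laplacian G) *\<^sub>v
      vec (card (verts G)) (\<lambda>j. x (vertex_enum G j))) $ i = qop G x (vertex_enum G i)"
proof -
  let ?n = "card (verts G)" and ?e = "vertex_enum G"
  note bij = bij_betw_vertex_enum[OF G]
  have fin: "finite (verts G)" by (rule simple_graphD(1)[OF G])
  have "(map_mat of_real (signless_laplacian G) *\<^sub>v vec ?n (\<lambda>j. x (?e j))) $ i =
      (\<Sum>j\<in>{0..<?n}. of_real (signless_laplacian G $$ (i, j)) * x (?e j))"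
    using i signless_laplacian_carrier[of G]
    by (auto simp: scalar_prod_def intro!: sum.cong)
  also have "\<dots> = (\<Sum>j\<in>{0..<?n}. (if i = j then of_nat (deg G (?e i)) * x (?e i) else 0) +
      (if adj G (?e i) (?e j) then x (?e j) else 0))"
    using i by (intro sum.cong)
      (auto simp: signless_laplacian_def degree_mat_def adjacency_mat_def algebra_simps)
  also have "\<dots> = of_nat (deg G (?e i)) * x (?e i) +
      (\<Sum>j\<in>{0..<?n}. if adj G (?e i) (?e j) then x (?e j) else 0)"
    using i by (simp add: sum.distrib)
  also have "(\<Sum>j\<in>{0..<?n}. if adj G (?e i) (?e j) then x (?e j) else 0) =
      (\<Sum>u\<in>verts G. if adj G (?e i) u then x u else 0)"
    by (rule sum.reindex_bij_betw[OF bij])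
  also have "\<dots> = (\<Sum>u\<in>nbrs G (?e i). x u)"
    unfolding nbrs_def using fin by (simp add: sum.inter_filter)
  also have "of_nat (deg G (?e i)) * x (?e i) = (\<Sum>u\<in>nbrs G (?e i). x (?e i))"
    by (simp add: deg_def nbrs_def)
  finally show ?thesis by (simp add: qop_def sum.distrib)
qed

text \<open>Eliminates the arbitrary vertex enumeration. The scalar type is kept general because the
  complex instance supplies an eigenvalue, while \<open>q_radius\<close> is about the real
  one.\<close>

lemma spectrum_signless_laplacian:
  fixes k :: "'b::{real_algebra_1,field}"
  assumes G: "simple_graph G"
  shows "k \<in> spectrum (map_mat of_real (signless_laplacian G)) \<longleftrightarrow>
    (\<exists>x. (\<exists>v\<in>verts G. x v \<noteq> 0) \<and> (\<forall>v\<in>verts G. qop G x v = k * x v))"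
proof -
  let ?n = "card (verts G)" and ?e = "vertex_enum G"
  let ?M = "map_mat of_real (signless_laplacian G) :: 'b mat"
  note bij = bij_betw_vertex_enum[OF G]
  have dim: "dim_row ?M = ?n" using signless_laplacian_carrier[of G] by simp
  have all: "(\<forall>v\<in>verts G. P v) \<longleftrightarrow> (\<forall>i<?n. P (?e i))" for P
  proof
    assume "\<forall>i<?n. P (?e i)"
    moreover have "v \<in> ?e ` {0..<?n}" if "v \<in> verts G" for v
      using that by (simp only: bij_betw_imp_surj_on[OF bij])
    ultimately show "\<forall>v\<in>verts G. P v" by fastforce
  qed (use bij_betwE[OF bij] in simp)
  have eq: "eigenvector ?M (vec ?n (\<lambda>j. x (?e j))) k \<longleftrightarrow>
      (\<exists>v\<in>verts G. x v \<noteq> 0) \<and> (\<forall>v\<in>verts G. qop G x v = k * x v)" for x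
  proof -
    have "vec ?n (\<lambda>j. x (?e j)) = 0\<^sub>v ?n \<longleftrightarrow> (\<forall>i<?n. x (?e i) = 0)"
      by (auto simp: vec_eq_iff)
    also have "\<dots> \<longleftrightarrow> (\<forall>v\<in>verts G. x v = 0)"
      by (rule all[symmetric])
    finally have 1: "vec ?n (\<lambda>j. x (?e j)) \<noteq> 0\<^sub>v ?n \<longleftrightarrow> (\<exists>v\<in>verts G. x v \<noteq> 0)" by blast
    have "?M *\<^sub>v vec ?n (\<lambda>j. x (?e j)) = k \<cdot>\<^sub>v vec ?n (\<lambda>j. x (?e j)) \<longleftrightarrow>
        (\<forall>i<?n. qop G x (?e i) = k * x (?e i))"
      using signless_laplacian_mult_vec[OF G, of _ x] dim by (auto simp: vec_eq_iff)
    also have "\<dots> \<longleftrightarrow> (\<forall>v\<in>verts G. qop G x v = k * x v)"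
      by (rule all[symmetric])
    finally show ?thesis using 1 unfolding eigenvector_def dim by simp
  qed
  have rep: "\<exists>x. w = vec ?n (\<lambda>j. x (?e j))" if "w \<in> carrier_vec ?n" for w :: "'b vec"
  proof
    show "w = vec ?n (\<lambda>j. (\<lambda>u. w $ (the_inv_into {0..<?n} ?e u)) (?e j))"
      using that the_inv_into_f_f[OF bij_betw_imp_inj_on[OF bij]] by (intro eq_vecI) auto
  qed
  show ?thesis
  proof
    assume "k \<in> spectrum ?M"
    then obtain w where w: "eigenvector ?M w k" by (auto simp: spectrum_def eigenvalue_def)
    then have "w \<in> carrier_vec ?n" unfolding eigenvector_def dim by simp
    then obtain x where x: "w = vec ?n (\<lambda>j. x (?e j))" using rep by blast
    show "\<exists>x. (\<exists>v\<in>verts G. x v \<noteq> 0) \<and> (\<forall>v\<in>verts G. qop G x v = k * x v)"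
      by (rule exI[of _ x], rule iffD1[OF eq]) (use w x in simp)
  next
    assume "\<exists>x. (\<exists>v\<in>verts G. x v \<noteq> 0) \<and> (\<forall>v\<in>verts G. qop G x v = k * x v)"
    then obtain x where "(\<exists>v\<in>verts G. x v \<noteq> 0) \<and> (\<forall>v\<in>verts G. qop G x v = k * x v)" ..
    then have "eigenvector ?M (vec ?n (\<lambda>j. x (?e j))) k" by (rule iffD2[OF eq])
    then show "k \<in> spectrum ?M" by (auto simp: spectrum_def eigenvalue_def)
  qed
qed

lemma map_mat_of_real_real: "map_mat (of_real :: real \<Rightarrow> real) A = A"
  by (intro eq_matI) auto

lemmas real_spectrum_signless_laplacian =
  spectrum_signless_laplacian[where 'b = real, unfolded map_mat_of_real_real]

text \<open>Self-adjointness: the Hermitian form \<open>?s\<close> is real, and it equals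
  \<open>k\<close> times the positive squared norm of \<open>z\<close>.\<close>

lemma eigenvalue_real:
  fixes z :: "'a \<Rightarrow> complex"
  assumes G: "simple_graph G" and z: "\<exists>v\<in>verts G. z v \<noteq> 0"
    and eig: "\<And>v. v \<in> verts G \<Longrightarrow> qop G z v = k * z v"
  shows "Im k = 0"
proof -
  have fin: "finite (verts G)" by (rule simple_graphD(1)[OF G])
  let ?s = "\<Sum>v\<in>verts G. cnj (z v) * qop G z v"
  let ?t = "\<Sum>v\<in>verts G. \<Sum>u\<in>verts G. if adj G v u then cnj (z v) * z u else 0"
  have "cnj ?t = (\<Sum>v\<in>verts G. \<Sum>u\<in>verts G. if adj G v u then z v * cnj (z u) else 0)"
    by (auto simp: intro!: sum.cong)
  also have "\<dots> = (\<Sum>u\<in>verts G. \<Sum>v\<in>verts G. if adj G v u then z v * cnj (z u) else 0)"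
    by (rule sum.swap)
  also have "\<dots> = ?t"
    by (intro sum.cong) (auto simp: adj_sym mult.commute)
  finally have "Im (cnj ?t) = Im ?t" by (rule arg_cong)
  then have t: "Im ?t = 0" unfolding cnj.sel by linarith
  have "cnj (z v) * qop G z v = of_real (real (deg G v) * (cmod (z v))\<^sup>2) +
      (\<Sum>u\<in>verts G. if adj G v u then cnj (z v) * z u else 0)" for v
  proof -
    have "cnj (z v) * qop G z v = of_nat (deg G v) * (z v * cnj (z v)) +
        (\<Sum>u\<in>nbrs G v. cnj (z v) * z u)"
      by (simp add: qop_def sum.distrib distrib_left sum_distrib_left deg_def nbrs_def)
    then show ?thesis
      using fin by (simp add: complex_norm_square sum.inter_filter nbrs_def flip: of_real_power)
  qed
  then have "Im ?s = 0" using t by (simp add: sum.distrib)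
  moreover have "?s = k * of_real (\<Sum>v\<in>verts G. (cmod (z v))\<^sup>2)"
    unfolding of_real_sum sum_distrib_left
    by (intro sum.cong) (simp_all add: eig complex_norm_square flip: of_real_power)
  ultimately have "Im k * (\<Sum>v\<in>verts G. (cmod (z v))\<^sup>2) = 0" by simp
  moreover have "(\<Sum>v\<in>verts G. (cmod (z v))\<^sup>2) \<noteq> 0"
    using z fin by (simp add: sum_nonneg_eq_0_iff)
  ultimately show ?thesis by simp
qed

text \<open>Needed for \<open>Max\<close> in \<open>q_radius\<close> to be attained. A complex
  eigenvalue exists and is real, and the real or the imaginary part of its eigenfunction is nonzero
  and again an eigenfunction.\<close>

lemma spectrum_signless_laplacian_nonempty:
  assumes G: "simple_graph G" and ne: "verts G \<noteq> {}"
  shows "spectrum (signless_laplacian G) \<noteq> {}"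
proof -
  have fin: "finite (verts G)" by (rule simple_graphD(1)[OF G])
  have "card (verts G) \<noteq> 0" using fin ne by simp
  then have "spectrum (map_mat complex_of_real (signless_laplacian G)) \<noteq> {}"
    using spectrum_non_empty signless_laplacian_carrier[of G] by (metis map_carrier_mat neq0_conv)
  then obtain k and z :: "'a \<Rightarrow> complex" where z: "\<exists>v\<in>verts G. z v \<noteq> 0"
    and eig: "\<And>v. v \<in> verts G \<Longrightarrow> qop G z v = k * z v"
    using spectrum_signless_laplacian[OF G] by blast
  have k: "Im k = 0" by (rule eigenvalue_real[OF G z eig])
  have re: "qop G (\<lambda>u. Re (z u)) v = Re k * Re (z v)" if "v \<in> verts G" for v
    using arg_cong[OF eig[OF that], of Re] k by (simp add: qop_def)
  have im: "qop G (\<lambda>u. Im (z u)) v = Re k * Im (z v)" if "v \<in> verts G" for v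
    using arg_cong[OF eig[OF that], of Im] k by (simp add: qop_def)
  have "\<exists>x. (\<exists>v\<in>verts G. x v \<noteq> 0) \<and> (\<forall>v\<in>verts G. qop G x v = Re k * x v)"
  proof (cases "\<exists>v\<in>verts G. Re (z v) \<noteq> 0")
    case True
    then show ?thesis by (intro exI[of _ "\<lambda>u. Re (z u)"]) (simp add: re)
  next
    case False
    then have "\<exists>v\<in>verts G. Im (z v) \<noteq> 0" using z by (auto simp: complex_eq_iff)
    then show ?thesis by (intro exI[of _ "\<lambda>u. Im (z u)"]) (simp add: im)
  qed
  then have "Re k \<in> spectrum (signless_laplacian G)"
    unfolding real_spectrum_signless_laplacian[OF G] .
  then show ?thesis by blast
qed

section \<open>Comparing the radius with eigenfunctions and test weights\<close>

lemma q_radius_ge: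
  assumes "simple_graph G" "v \<in> verts G" "x v \<noteq> 0"
    and "\<And>v. v \<in> verts G \<Longrightarrow> qop G x v = k * x v"
  shows "k \<le> q_radius G"
  unfolding q_radius_def
proof (rule Max_ge)
  show "finite (spectrum (signless_laplacian G))"
    by (rule card_finite_spectrum(1)[OF signless_laplacian_carrier])
  show "k \<in> spectrum (signless_laplacian G)"
    unfolding real_spectrum_signless_laplacian[OF assms(1)]
    using assms(2-4) by (intro exI[of _ x]) auto
qed

lemma q_radius_eigenfunction:
  assumes "simple_graph G" "verts G \<noteq> {}"
  obtains x where "\<exists>v\<in>verts G. x v \<noteq> 0" "\<And>v. v \<in> verts G \<Longrightarrow> qop G x v = q_radius G * x v"
proof -
  have "q_radius G \<in> spectrum (signless_laplacian G)"
    unfolding q_radius_def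
    by (rule Max_in[OF card_finite_spectrum(1)[OF signless_laplacian_carrier]
          spectrum_signless_laplacian_nonempty[OF assms]])
  then obtain x where "(\<exists>v\<in>verts G. x v \<noteq> 0) \<and> (\<forall>v\<in>verts G. qop G x v = q_radius G * x v)"
    unfolding real_spectrum_signless_laplacian[OF assms(1)] ..
  then show ?thesis using that[of x] by simp
qed

text \<open>An eigenfunction \<open>x\<close> is compared with \<open>c\<close> at a vertex
  \<open>r\<close> where the ratio of the absolute value of \<open>x\<close> to \<open>c\<close> is
  largest. If the bound is attained, every neighbour of such a vertex is again one, and
  connectedness carries equality to all vertices.\<close>

lemma collatz_wielandt:
  assumes G: "simple_graph G" and ne: "verts G \<noteq> {}"
    and pos: "\<And>v. v \<in> verts G \<Longrightarrow> 0 < c v"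
    and le: "\<And>v. v \<in> verts G \<Longrightarrow> qop G c v \<le> K * c v"
  shows "q_radius G \<le> K"
    and "connected_graph G \<Longrightarrow> K \<le> q_radius G \<Longrightarrow> v \<in> verts G \<Longrightarrow> qop G c v = K * c v"
proof -
  let ?q = "q_radius G"
  obtain x where x: "\<exists>v\<in>verts G. x v \<noteq> 0"
    and eig: "\<And>v. v \<in> verts G \<Longrightarrow> qop G x v = ?q * x v"
    using q_radius_eigenfunction[OF G ne] by blast
  have fin: "finite (verts G)" by (rule simple_graphD(1)[OF G])
  define M where "M = Max ((\<lambda>v. \<bar>x v\<bar> / c v) ` verts G)"
  have xM: "\<bar>x v\<bar> \<le> M * c v" if "v \<in> verts G" for v
  proof -
    have "\<bar>x v\<bar> / c v \<le> M" unfolding M_def using fin that by (intro Max_ge) auto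
    then show ?thesis using pos[OF that] by (simp add: pos_divide_le_eq)
  qed
  obtain w where w: "w \<in> verts G" "x w \<noteq> 0" using x by blast
  have "0 < M * c w" using xM[OF w(1)] w(2) by linarith
  then have Mpos: "0 < M" using pos[OF w(1)] by (simp add: zero_less_mult_iff)
  have chain: "?q * \<bar>x v\<bar> \<le> (\<Sum>u\<in>nbrs G v. \<bar>x v\<bar> + \<bar>x u\<bar>)" if v: "v \<in> verts G" for v
  proof -
    have "?q * \<bar>x v\<bar> \<le> \<bar>?q * x v\<bar>" by (simp add: abs_mult mult_right_mono)
    also have "\<dots> = \<bar>\<Sum>u\<in>nbrs G v. x v + x u\<bar>" using eig[OF v] by (simp add: qop_def)
    also have "\<dots> \<le> (\<Sum>u\<in>nbrs G v. \<bar>x v\<bar> + \<bar>x u\<bar>)"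
      by (rule order_trans[OF sum_abs sum_mono[OF abs_triangle_ineq]])
    finally show ?thesis .
  qed
  have up: "(\<Sum>u\<in>nbrs G v. \<bar>x v\<bar> + \<bar>x u\<bar>) \<le> M * qop G c v" if v: "v \<in> verts G" for v
    unfolding qop_def sum_distrib_left
    by (intro sum_mono) (use xM v in \<open>auto simp: nbrs_def distrib_left intro: add_mono\<close>)
  have upK: "M * qop G c v \<le> K * (M * c v)" if v: "v \<in> verts G" for v
    using mult_left_mono[OF le[OF v], of M] Mpos by (simp add: algebra_simps)
  have "M \<in> (\<lambda>v. \<bar>x v\<bar> / c v) ` verts G" unfolding M_def using fin ne by (intro Max_in) auto
  then obtain r where r: "r \<in> verts G" "M = \<bar>x r\<bar> / c r" by blast
  have rM: "\<bar>x r\<bar> = M * c r" using r(2) pos[OF r(1)] by simp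
  have "?q * (M * c r) \<le> K * (M * c r)" using chain up upK rM r(1) by fastforce
  then show "?q \<le> K" using Mpos pos[OF r(1)] by (simp add: mult_le_cancel_right)
  assume conn: "connected_graph G" and K: "K \<le> ?q" and v: "v \<in> verts G"
  \<comment> \<open>At a vertex of maximal ratio the estimates close up into a cycle, so all are
    equalities; equality of the sums forces equality of each summand.\<close>
  have tight: "qop G c y = K * c y \<and> (\<forall>u\<in>nbrs G y. \<bar>x u\<bar> = M * c u)"
    if y: "y \<in> verts G" "\<bar>x y\<bar> = M * c y" for y
  proof -
    have "K * (M * c y) \<le> ?q * \<bar>x y\<bar>"
      using K y Mpos pos[OF y(1)] by (simp add: mult_right_mono)
    then have eq1: "M * qop G c y = K * (M * c y)"
      and eq2: "(\<Sum>u\<in>nbrs G y. \<bar>x y\<bar> + \<bar>x u\<bar>) = M * qop G c y"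
      using chain[OF y(1)] up[OF y(1)] upK[OF y(1)] by linarith+
    have "qop G c y = K * c y" using eq1 Mpos by simp
    moreover have "\<bar>x u\<bar> = M * c u" if u: "u \<in> nbrs G y" for u
    proof -
      have 2: "(\<Sum>u\<in>nbrs G y. \<bar>x y\<bar> + \<bar>x u\<bar>) = (\<Sum>u\<in>nbrs G y. M * (c y + c u))"
        using eq2 by (simp only: qop_def sum_distrib_left)
      have "\<bar>x y\<bar> + \<bar>x u\<bar> = M * (c y + c u)"
        by (rule sum_mono_inv[OF 2 _ u finite_nbrs[OF G]])
          (use xM y in \<open>auto simp: nbrs_def distrib_left\<close>)
      then show ?thesis using y(2) by (simp add: distrib_left)
    qed
    ultimately show ?thesis by blast
  qed
  have "(r, v) \<in> {(x, y). adj G x y}\<^sup>*" using conn r(1) v by (simp add: connected_graph_def)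
  then have "v \<in> verts G \<and> \<bar>x v\<bar> = M * c v"
  proof (induction rule: rtrancl_induct)
    case base
    then show ?case using r(1) rM by simp
  next
    case (step y z)
    then have "z \<in> nbrs G y" using adjD(2)[OF G, of y z] by (simp add: nbrs_def)
    then show ?case using tight[of y] step.IH by (simp add: nbrs_def)
  qed
  then show "qop G c v = K * c v" using tight by blast
qed

section \<open>The extremal graph\<close>

lemma simple_complete_graph: "simple_graph (complete_graph m)"
  by (auto simp: simple_graph_def complete_graph_def)

lemma adj_complete_graph: "adj (complete_graph m) u v \<longleftrightarrow> u < m \<and> v < m \<and> u \<noteq> v"
  by (auto simp: adj_def complete_graph_def doubleton_eq_iff)

lemma simple_graph_copies: "simple_graph G \<Longrightarrow> simple_graph (graph_copies m G)"
  by (fastforce simp: simple_graph_def graph_copies_def card_image inj_on_def)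

lemma simple_graph_union: "simple_graph G \<Longrightarrow> simple_graph H \<Longrightarrow> simple_graph (graph_union G H)"
  by (fastforce simp: simple_graph_def graph_union_def card_image inj_on_def)

lemma simple_graph_join:
  assumes "simple_graph G" "simple_graph H"
  shows "simple_graph (graph_join G H)"
  using simple_graph_union[OF assms] assms
  by (auto simp: simple_graph_def graph_join_def graph_union_def)

lemma adj_graph_copies_complete_1: "\<not> adj (graph_copies m (complete_graph 1)) u v"
  by (auto simp: adj_def graph_copies_def complete_graph_def)

lemma doubleton_image_iff:
  assumes "inj f"
  shows "{f u, f v} \<in> (`) f ` E \<longleftrightarrow> {u, v} \<in> E"
proof -
  have "inj ((`) f)" using assms by (simp add: inj_def inj_image_eq_iff)
  then have "f ` {u, v} \<in> (`) f ` E \<longleftrightarrow> {u, v} \<in> E" by (rule inj_image_mem_iff)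
  then show ?thesis by simp
qed

lemma Inl_notin_Inr_image: "insert (Inl u) A \<notin> (`) Inr ` E"
  "insert (Inr u') A' \<notin> (`) Inl ` E'"
  by auto

lemma adj_graph_union:
  "adj (graph_union G H) (Inl u) (Inl v) \<longleftrightarrow> adj G u v"
  "adj (graph_union G H) (Inr u') (Inr v') \<longleftrightarrow> adj H u' v'"
  "\<not> adj (graph_union G H) (Inl u) (Inr v')" "\<not> adj (graph_union G H) (Inr v') (Inl u)"
proof -
  have "{Inl u, Inr v'} \<notin> (`) Inl ` edges G" "{Inl u, Inr v'} \<notin> (`) Inr ` edges H"
    using Inl_notin_Inr_image(2)[of v' "{Inl u}" "edges G"]
      Inl_notin_Inr_image(1)[of u "{Inr v'}" "edges H"]
    by (simp_all add: insert_commute)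
  then show "\<not> adj (graph_union G H) (Inl u) (Inr v')" "\<not> adj (graph_union G H) (Inr v') (Inl u)"
    by (simp_all add: adj_def graph_union_def insert_commute)
qed (simp_all add: adj_def graph_union_def doubleton_image_iff
    Inl_notin_Inr_image)

lemma adj_graph_join:
  "adj (graph_join G H) (Inl u) (Inl v) \<longleftrightarrow> adj G u v"
  "adj (graph_join G H) (Inr u') (Inr v') \<longleftrightarrow> adj H u' v'"
  "adj (graph_join G H) (Inl u) (Inr v') \<longleftrightarrow> u \<in> verts G \<and> v' \<in> verts H"
  "adj (graph_join G H) (Inr v') (Inl u) \<longleftrightarrow> u \<in> verts G \<and> v' \<in> verts H"
proof -
  have *: "adj (graph_join G H) x y \<longleftrightarrow> adj (graph_union G H) x y \<or>
      {x, y} \<in> {{Inl u, Inr v} | u v. u \<in> verts G \<and> v \<in> verts H}" for x y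
    by (simp add: adj_def graph_join_def)
  show "adj (graph_join G H) (Inl u) (Inl v) \<longleftrightarrow> adj G u v"
    "adj (graph_join G H) (Inr u') (Inr v') \<longleftrightarrow> adj H u' v'"
    "adj (graph_join G H) (Inl u) (Inr v') \<longleftrightarrow> u \<in> verts G \<and> v' \<in> verts H"
    "adj (graph_join G H) (Inr v') (Inl u) \<longleftrightarrow> u \<in> verts G \<and> v' \<in> verts H"
    unfolding * by (auto simp: adj_graph_union doubleton_eq_iff)
qed

text \<open>Neighbourhoods in the join of a clique on \<open>S\<close> with a clique on
  \<open>C\<close> and independent \<open>I\<close>, on arbitrary vertex sets; the pattern serves
  both for the extremal graph and as an upper bound for neighbourhoods in \<open>G\<close>.\<close>

definition full_nbrs :: "'a set \<Rightarrow> 'a set \<Rightarrow> 'a set \<Rightarrow> 'a \<Rightarrow> 'a set" where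
  "full_nbrs S C I v = {u \<in> S \<union> C \<union> I. u \<noteq> v \<and> (u \<in> S \<or> v \<in> S \<or> u \<in> C \<and> v \<in> C)}"

lemma finite_full_nbrs: "finite S \<Longrightarrow> finite C \<Longrightarrow> finite I \<Longrightarrow> finite (full_nbrs S C I v)"
  by (simp add: full_nbrs_def)

text \<open>The rows of the quotient matrix for the partition into \<open>S\<close>,
  \<open>C\<close>, \<open>I\<close>, applied to the vector \<open>(1, w, z)\<close>.\<close>

lemma full_nbrs_sum:
  fixes w z :: real and c :: "'a \<Rightarrow> real"
  assumes fin: "finite S" "finite C" "finite I"
    and disj: "S \<inter> C = {}" "S \<inter> I = {}" "C \<inter> I = {}"
    and c: "\<forall>u\<in>S. c u = 1" "\<forall>u\<in>C. c u = w" "\<forall>u\<in>I. c u = z"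
  shows "v \<in> S \<Longrightarrow> (\<Sum>u\<in>full_nbrs S C I v. c v + c u) =
      2 * (real (card S) - 1) + card C * (1 + w) + card I * (1 + z)"
    and "v \<in> C \<Longrightarrow> (\<Sum>u\<in>full_nbrs S C I v. c v + c u) =
      card S * (w + 1) + (real (card C) - 1) * (2 * w)"
    and "v \<in> I \<Longrightarrow> (\<Sum>u\<in>full_nbrs S C I v. c v + c u) = card S * (z + 1)"
proof -
  have pos: "real (card A - Suc 0) = real (card A) - 1" if "finite A" "x \<in> A" for A and x :: 'a
  proof -
    have "card A \<noteq> 0" using that by auto
    then show ?thesis by (simp add: of_nat_diff)
  qed
  {
    assume v: "v \<in> S"
    then have eq: "full_nbrs S C I v = (S - {v}) \<union> C \<union> I"
      using disj by (auto simp: full_nbrs_def)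
    have "(\<Sum>u\<in>full_nbrs S C I v. c v + c u) =
        (\<Sum>u\<in>S - {v}. c v + c u) + (\<Sum>u\<in>C. c v + c u) + (\<Sum>u\<in>I. c v + c u)"
      unfolding eq using fin disj by (subst sum.union_disjoint; (subst sum.union_disjoint)?) auto
    then show "(\<Sum>u\<in>full_nbrs S C I v. c v + c u) =
        2 * (real (card S) - 1) + card C * (1 + w) + card I * (1 + z)"
      using v fin pos[OF fin(1) v] by (simp add: c)
  }
  {
    assume v: "v \<in> C"
    then have eq: "full_nbrs S C I v = S \<union> (C - {v})"
      using disj by (auto simp: full_nbrs_def)
    have "(\<Sum>u\<in>full_nbrs S C I v. c v + c u) = (\<Sum>u\<in>S. c v + c u) + (\<Sum>u\<in>C - {v}. c v + c u)"
      unfolding eq using fin disj by (subst sum.union_disjoint) auto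
    then show "(\<Sum>u\<in>full_nbrs S C I v. c v + c u) =
        card S * (w + 1) + (real (card C) - 1) * (2 * w)"
      using v fin pos[OF fin(2) v] by (simp add: c)
  }
  {
    assume v: "v \<in> I"
    then have "full_nbrs S C I v = S"
      using disj by (auto simp: full_nbrs_def)
    then show "(\<Sum>u\<in>full_nbrs S C I v. c v + c u) = card S * (z + 1)"
      using v by (simp add: c)
  }
qed

section \<open>The quotient eigenvector of the extremal graph\<close>

abbreviation (input) extremal_graph :: "nat \<Rightarrow> nat \<Rightarrow> nat \<Rightarrow> (nat + nat + nat \<times> nat) graph" where
  "extremal_graph d m l \<equiv> graph_join (complete_graph d)
     (graph_union (complete_graph m) (graph_copies l (complete_graph 1)))"

lemma simple_extremal_graph: "simple_graph (extremal_graph d m l)"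
  by (intro simple_graph_join simple_graph_union simple_graph_copies simple_complete_graph)

lemma verts_extremal_graph:
  "verts (extremal_graph d m l) =
    Inl ` {..<d} \<union> Inr ` Inl ` {..<m} \<union> Inr ` Inr ` ({..<l} \<times> {..<1})"
  by (auto simp: graph_join_def graph_union_def complete_graph_def graph_copies_def)

lemma adj_extremal_graph:
  assumes "x \<in> verts (extremal_graph d m l)" "y \<in> verts (extremal_graph d m l)"
  shows "adj (extremal_graph d m l) x y \<longleftrightarrow>
    x \<in> full_nbrs (Inl ` {..<d}) (Inr ` Inl ` {..<m}) (Inr ` Inr ` ({..<l} \<times> {..<1})) y"
proof -
  have v: "verts (complete_graph k) = {..<k}"
    "verts (graph_union (complete_graph m) (graph_copies l (complete_graph 1))) =
      Inl ` {..<m} \<union> Inr ` ({..<l} \<times> {..<1})" for k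
    by (auto simp: graph_union_def complete_graph_def graph_copies_def)
  show ?thesis
    using assms unfolding verts_extremal_graph full_nbrs_def
    by (elim UnE imageE; simp add: adj_graph_join adj_graph_union adj_complete_graph
        adj_graph_copies_complete_1 v image_iff del: One_nat_def; fastforce)
qed

text \<open>The three equations say that \<open>(1, w, z)\<close> is an eigenvector of the quotient matrix with eigenvalue
  \<open>q\<close>. Solving the last two for \<open>w\<close> and \<open>z\<close> leaves one equation for \<open>q\<close>, whose left-hand side is
  negative at \<open>K\<close>.\<close>

lemma extremal_root:
  fixes K :: real and d m l :: nat
  assumes d: "1 \<le> d" and m: "1 \<le> m" and K: "real d + 2 * (real m - 1) < K"
    and neg: "K - 2 * (real d - 1) - m - l - m * (d / (K - d - 2 * (real m - 1))) - l * (d / (K - d)) < 0"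
  obtains q w z :: real where "K < q" "0 < w" "0 < z"
    "2 * (real d - 1) + m * (1 + w) + l * (1 + z) = q"
    "d * (w + 1) + (real m - 1) * (2 * w) = q * w" "d * (z + 1) = q * z"
proof -
  define w where "w = (\<lambda>q::real. d / (q - d - 2 * (real m - 1)))"
  define z where "z = (\<lambda>q::real. d / (q - real d))"
  define f where "f = (\<lambda>q::real. q - 2 * (real d - 1) - m - l - m * w q - l * z q)"
  have dm: "real d \<ge> 1" "real m \<ge> 1" using d m by simp_all
  \<comment> \<open>Chosen so large that \<open>w U\<close> and \<open>z U\<close> are at most
    \<open>1\<close>, whence \<open>f U\<close> is nonnegative.\<close>
  define U where "U = max K (2 * (real d + m + l))"
  have "f K < 0" using neg by (simp add: f_def w_def z_def)
  have U: "U \<ge> K" "U \<ge> 2 * (real d + m + l)" by (simp_all add: U_def)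
  have "w U \<le> 1" "z U \<le> 1" using U dm by (auto simp: w_def z_def divide_le_eq)
  then have "m * w U \<le> m" "l * z U \<le> l" by (simp_all add: mult_left_le)
  then have "0 \<le> f U" using U by (simp add: f_def)
  \<comment> \<open>Both poles of \<open>f\<close> lie below \<open>K\<close>.\<close>
  moreover have "continuous_on {K..U} f"
    unfolding f_def w_def z_def using K dm by (intro continuous_intros) auto
  ultimately obtain q where q: "K \<le> q" "q \<le> U" "f q = 0"
    using IVT'[of f K 0 U] U \<open>f K < 0\<close> by auto
  have "K < q" using q \<open>f K < 0\<close> by (cases "q = K") auto
  have pos1: "0 < q - real d - 2 * (real m - 1)" using K \<open>K < q\<close> by linarith
  have pos2: "0 < q - real d" using pos1 dm(2) by (simp add: algebra_simps)
  note pos = pos1 pos2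
  show ?thesis
  proof (rule that[OF \<open>K < q\<close>, of "w q" "z q"])
    show "0 < w q" "0 < z q" using pos dm by (simp_all add: w_def z_def)
    show "2 * (real d - 1) + m * (1 + w q) + l * (1 + z q) = q"
      using q(3) by (simp add: f_def algebra_simps)
    have "w q * (q - d - 2 * (real m - 1)) = d" using pos by (simp add: w_def)
    then show "d * (w q + 1) + (real m - 1) * (2 * w q) = q * w q" by (simp add: algebra_simps)
    have "z q * (q - d) = d" using pos by (simp add: z_def)
    then show "d * (z q + 1) = q * z q" by (simp add: algebra_simps)
  qed
qed

text \<open>The quotient eigenvector lifts to an eigenfunction that is constant on each of the three
  parts.\<close>

lemma extremal_root_le_q_radius:
  fixes q w z :: real and d m l :: nat
  assumes d: "1 \<le> d" and w: "0 < w"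
    and eqs: "2 * (real d - 1) + m * (1 + w) + l * (1 + z) = q"
    "d * (w + 1) + (real m - 1) * (2 * w) = q * w" "d * (z + 1) = q * z"
  shows "q \<le> q_radius (extremal_graph d m l)"
proof -
  let ?S = "Inl ` {..<d} :: (nat + nat + nat \<times> nat) set"
  let ?C = "Inr ` Inl ` {..<m} :: (nat + nat + nat \<times> nat) set"
  let ?I = "Inr ` Inr ` ({..<l} \<times> {..<1}) :: (nat + nat + nat \<times> nat) set"
  let ?H = "extremal_graph d m l"
  define c where "c = (\<lambda>v. if v \<in> ?S then 1 else if v \<in> ?C then w else z)"
  have cards: "card ?S = d" "card ?C = m" "card ?I = l"
    by (simp_all add: card_image inj_on_def)
  have fin: "finite ?S" "finite ?C" "finite ?I" by simp_all
  have disj: "?S \<inter> ?C = {}" "?S \<inter> ?I = {}" "?C \<inter> ?I = {}" by auto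
  have cv: "\<forall>v\<in>?S. c v = 1" "\<forall>v\<in>?C. c v = w" "\<forall>v\<in>?I. c v = z"
    by (auto simp: c_def)
  note sums = full_nbrs_sum[where c = c, OF fin disj cv, unfolded cards eqs]
  have nb: "nbrs ?H v = full_nbrs ?S ?C ?I v" if v: "v \<in> verts ?H" for v
  proof -
    have "u \<in> verts ?H" if "u \<in> full_nbrs ?S ?C ?I v" for u
      using that unfolding full_nbrs_def verts_extremal_graph by blast
    then show ?thesis
      using adj_extremal_graph[OF _ v] unfolding nbrs_def by (auto simp: adj_sym[of _ v])
  qed
  have "qop ?H c v = q * c v" if v: "v \<in> verts ?H" for v
  proof -
    consider "v \<in> ?S" | "v \<in> ?C" | "v \<in> ?I" using v unfolding verts_extremal_graph by blast
    then show ?thesis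
      unfolding qop_def nb[OF v]
    proof cases
      case 1
      show "(\<Sum>u\<in>full_nbrs ?S ?C ?I v. c v + c u) = q * c v"
        unfolding sums(1)[OF 1] using cv(1)[rule_format, OF 1] by simp
    next
      case 2
      show "(\<Sum>u\<in>full_nbrs ?S ?C ?I v. c v + c u) = q * c v"
        unfolding sums(2)[OF 2] using cv(2)[rule_format, OF 2] by simp
    next
      case 3
      show "(\<Sum>u\<in>full_nbrs ?S ?C ?I v. c v + c u) = q * c v"
        unfolding sums(3)[OF 3] using cv(3)[rule_format, OF 3] by simp
    qed
  qed
  moreover have "Inl 0 \<in> verts ?H" "c (Inl 0) \<noteq> 0"
    using d unfolding verts_extremal_graph by (auto simp: c_def)
  ultimately show ?thesis by (rule q_radius_ge[OF simple_extremal_graph, rotated 2])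
qed

text \<open>\<open>?K\<close> is the radius of the complete graph on \<open>d + m\<close> vertices.
  There the weight on the middle part would be exactly \<open>1\<close>, and the remaining terms are
  negative because \<open>l\<close> is positive.\<close>

lemma extremal_root_dense:
  fixes d m l :: nat
  assumes "1 \<le> d" "1 \<le> m" "1 \<le> l"
  obtains q w z :: real where "2 * (real d + real m - 1) < q" "0 < w" "0 < z"
    "2 * (real d - 1) + m * (1 + w) + l * (1 + z) = q"
    "d * (w + 1) + (real m - 1) * (2 * w) = q * w" "d * (z + 1) = q * z"
proof (rule extremal_root)
  let ?K = "2 * (real d + real m - 1)"
  show "real d + 2 * (real m - 1) < ?K" using assms(1) by simp
  have "?K - d - 2 * (real m - 1) = d" by (simp add: algebra_simps)
  then have 1: "m * (d / (?K - d - 2 * (real m - 1))) = m" using assms by simp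
  have 2: "0 \<le> l * (d / (?K - d))" using assms by simp
  have 3: "1 \<le> real l" using assms(3) by simp
  have 4: "?K - 2 * (real d - 1) - m - l - m - y < 0" if "0 \<le> y" for y :: real
    using 3 that by (simp add: algebra_simps)
  show "?K - 2 * (real d - 1) - m - l - m * (d / (?K - d - 2 * (real m - 1))) -
      l * (d / (?K - d)) < 0"
    unfolding 1 by (rule 4[OF 2])
qed (use assms that in auto)

lemma q_radius_extremal_graph_gt:
  assumes "1 \<le> d" "1 \<le> m" "1 \<le> l"
  shows "2 * (real d + real m - 1) < q_radius (extremal_graph d m l)"
proof -
  obtain q w z :: real where "2 * (real d + real m - 1) < q" and
    eqs: "0 < w" "2 * (real d - 1) + m * (1 + w) + l * (1 + z) = q"
    "d * (w + 1) + (real m - 1) * (2 * w) = q * w" "d * (z + 1) = q * z"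
    by (rule extremal_root_dense[OF assms])
  then show ?thesis using extremal_root_le_q_radius[OF assms(1) eqs] by linarith
qed

text \<open>By \<open>sep\<close>, neighbourhoods in \<open>G\<close> lie inside the full pattern,
  so the Perron weights of the extremal graph satisfy the Collatz-Wielandt inequality on
  \<open>G\<close>. The radius hypothesis forces equality, which leaves no edge missing.\<close>

lemma extremal_case:
  assumes G: "simple_graph G" and conn: "connected_graph G"
    and q: "q_radius (extremal_graph d m l) \<le> q_radius G"
    and V: "verts G = S \<union> C \<union> I"
    and disj: "S \<inter> C = {}" "S \<inter> I = {}" "C \<inter> I = {}"
    and cards: "card S = d" "card C = m" "card I = l" and pos: "1 \<le> d" "1 \<le> m" "1 \<le> l"
    and sep: "\<And>u v. adj G u v \<Longrightarrow> u \<in> I \<Longrightarrow> v \<in> S"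
  shows "graph_iso G (extremal_graph d m l)"
proof -
  let ?H = "extremal_graph d m l"
  have ne: "verts G \<noteq> {}" using conn by (simp add: connected_graph_def)
  have fin: "finite S" "finite C" "finite I"
    using simple_graphD(1)[OF G] by (simp_all add: V)
  obtain q w z :: real where wz: "0 < w" "0 < z" and
    eqs: "2 * (real d - 1) + m * (1 + w) + l * (1 + z) = q"
    "d * (w + 1) + (real m - 1) * (2 * w) = q * w" "d * (z + 1) = q * z"
    by (rule extremal_root_dense[OF pos])
  have le: "q \<le> q_radius G"
    using extremal_root_le_q_radius[OF pos(1) wz(1) eqs] q by simp
  define c where "c = (\<lambda>v. if v \<in> S then 1 else if v \<in> C then w else z)"
  have cv: "\<forall>v\<in>S. c v = 1" "\<forall>v\<in>C. c v = w" "\<forall>v\<in>I. c v = z"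
    using disj by (auto simp: c_def)
  note sums = full_nbrs_sum[where c = c, OF fin disj cv, unfolded cards eqs]
  have c_pos: "0 < c v" for v using wz by (simp add: c_def)
  have full: "(\<Sum>u\<in>full_nbrs S C I v. c v + c u) = q * c v" if v: "v \<in> verts G" for v
  proof -
    consider "v \<in> S" | "v \<in> C" | "v \<in> I" using v unfolding V by blast
    then show ?thesis
    proof cases
      case 1
      show ?thesis unfolding sums(1)[OF 1] using cv(1)[rule_format, OF 1] by simp
    next
      case 2
      show ?thesis unfolding sums(2)[OF 2] using cv(2)[rule_format, OF 2] by simp
    next
      case 3
      show ?thesis unfolding sums(3)[OF 3] using cv(3)[rule_format, OF 3] by simp
    qed
  qed
  have sub: "nbrs G v \<subseteq> full_nbrs S C I v" if v: "v \<in> verts G" for v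
  proof
    fix u assume "u \<in> nbrs G v"
    then have u: "u \<in> verts G" "adj G v u" by (auto simp: nbrs_def)
    moreover have "adj G u v" using u(2) by (simp add: adj_sym)
    ultimately show "u \<in> full_nbrs S C I v"
      using sep[of u v] sep[of v u] adjD(3)[OF G u(2)] v V by (auto simp: full_nbrs_def)
  qed
  have fin_full: "finite (full_nbrs S C I v)" for v by (rule finite_full_nbrs[OF fin])
  have nn: "0 < c v + c u" for u v using c_pos[of u] c_pos[of v] by simp
  have up: "qop G c v \<le> q * c v" if v: "v \<in> verts G" for v
    unfolding full[OF v, symmetric] qop_def
    by (rule sum_mono2[OF fin_full sub[OF v]]) (use nn in \<open>simp add: less_imp_le\<close>)
  have eq: "qop G c v = q * c v" if v: "v \<in> verts G" for v
    by (rule collatz_wielandt(2)[OF G ne c_pos _ conn le v]) (rule up)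
  \<comment> \<open>All weights are positive, so a missing neighbour would make the row sum strictly
    smaller.\<close>
  have nb: "nbrs G v = full_nbrs S C I v" if v: "v \<in> verts G" for v
  proof (rule ccontr)
    assume "nbrs G v \<noteq> full_nbrs S C I v"
    then obtain u where u: "u \<in> full_nbrs S C I v - nbrs G v" using sub[OF v] by blast
    have "qop G c v < (\<Sum>u\<in>full_nbrs S C I v. c v + c u)"
      unfolding qop_def
      by (rule sum_strict_mono2[OF fin_full sub[OF v] u nn]) (use nn in \<open>simp add: less_imp_le\<close>)
    then show False using eq[OF v] full[OF v] by simp
  qed
  \<comment> \<open>Once all neighbourhoods are full, any bijection that respects the three parts is
    an isomorphism.\<close>
  let ?S = "Inl ` {..<d} :: (nat + nat + nat \<times> nat) set"
  let ?C = "Inr ` Inl ` {..<m} :: (nat + nat + nat \<times> nat) set"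
  let ?I = "Inr ` Inr ` ({..<l} \<times> {..<1}) :: (nat + nat + nat \<times> nat) set"
  have cards': "card ?S = d" "card ?C = m" "card ?I = l"
    by (simp_all add: card_image inj_on_def)
  obtain hS where hS: "bij_betw hS S ?S"
    using finite_same_card_bij[OF fin(1), of ?S] cards cards' by auto
  obtain hC where hC: "bij_betw hC C ?C"
    using finite_same_card_bij[OF fin(2), of ?C] cards cards' by auto
  obtain hI where hI: "bij_betw hI I ?I"
    using finite_same_card_bij[OF fin(3), of ?I] cards cards' by auto
  define f where "f = (\<lambda>v. if v \<in> S then hS v else if v \<in> C then hC v else hI v)"
  have fS: "bij_betw f S ?S"
    using hS by (rule bij_betw_cong[THEN iffD1, rotated]) (simp add: f_def)
  have fC: "bij_betw f C ?C"
    using hC by (rule bij_betw_cong[THEN iffD1, rotated]) (use disj in \<open>auto simp: f_def\<close>)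
  have fI: "bij_betw f I ?I"
    using hI by (rule bij_betw_cong[THEN iffD1, rotated]) (use disj in \<open>auto simp: f_def\<close>)
  have "bij_betw f (S \<union> C) (?S \<union> ?C)" by (rule bij_betw_combine[OF fS fC]) auto
  then have bij: "bij_betw f (verts G) (verts ?H)"
    unfolding V verts_extremal_graph by (rule bij_betw_combine[OF _ fI]) auto
  have mem: "(f v \<in> ?S \<longleftrightarrow> v \<in> S) \<and> (f v \<in> ?C \<longleftrightarrow> v \<in> C)" if v: "v \<in> verts G" for v
  proof -
    consider "v \<in> S" "v \<notin> C" | "v \<in> C" "v \<notin> S" | "v \<in> I" "v \<notin> S" "v \<notin> C"
      using v disj unfolding V by auto
    then show ?thesis
    proof cases
      case 1
      then have "f v \<in> ?S" using bij_betwE[OF fS] by blast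
      moreover from this have "f v \<notin> ?C" by auto
      ultimately show ?thesis using 1 by simp
    next
      case 2
      then have "f v \<in> ?C" using bij_betwE[OF fC] by blast
      moreover from this have "f v \<notin> ?S" by auto
      ultimately show ?thesis using 2 by simp
    next
      case 3
      then have "f v \<in> ?I" using bij_betwE[OF fI] by blast
      then have "f v \<notin> ?S" "f v \<notin> ?C" by auto
      then show ?thesis using 3 by simp
    qed
  qed
  have "adj G u v \<longleftrightarrow> adj ?H (f u) (f v)" if u: "u \<in> verts G" and v: "v \<in> verts G" for u v
  proof -
    have fu: "f u \<in> verts ?H" and fv: "f v \<in> verts ?H" using bij_betwE[OF bij] u v by blast+
    have inj: "f u = f v \<longleftrightarrow> u = v"
      using bij_betw_imp_inj_on[OF bij] u v by (auto dest: inj_onD)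
    have "adj G u v \<longleftrightarrow> u \<in> nbrs G v" using u by (simp add: nbrs_def adj_sym)
    also have "\<dots> \<longleftrightarrow> u \<noteq> v \<and> (u \<in> S \<or> v \<in> S \<or> u \<in> C \<and> v \<in> C)"
      unfolding nb[OF v] using u V by (simp add: full_nbrs_def)
    also have "\<dots> \<longleftrightarrow> f u \<noteq> f v \<and> (f u \<in> ?S \<or> f v \<in> ?S \<or> f u \<in> ?C \<and> f v \<in> ?C)"
      using mem[OF u] mem[OF v] inj by blast
    also have "\<dots> \<longleftrightarrow> f u \<in> full_nbrs ?S ?C ?I (f v)"
      using fu unfolding full_nbrs_def verts_extremal_graph by blast
    also have "\<dots> \<longleftrightarrow> adj ?H (f u) (f v)" by (rule adj_extremal_graph[OF fu fv, symmetric])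
    finally show ?thesis .
  qed
  then show ?thesis unfolding graph_iso_def using bij by blast
qed

text \<open>Vertices of \<open>S\<close> and \<open>C\<close> are estimated by full neighbourhoods,
  there being no edges between \<open>C\<close> and \<open>R\<close>. Since \<open>R\<close> may
  contain edges, its row uses the actual number of neighbours outside \<open>S\<close>.\<close>

lemma weighted_bound:
  fixes w z K :: real
  assumes G: "simple_graph G" and V: "verts G = S \<union> C \<union> R"
    and disj: "S \<inter> C = {}" "S \<inter> R = {}" "C \<inter> R = {}" and ne: "verts G \<noteq> {}"
    and sep: "\<And>u v. adj G u v \<Longrightarrow> u \<in> R \<Longrightarrow> v \<in> S \<union> R"
    and wz: "0 < w" "0 < z"
    and S_row: "2 * (real (card S) - 1) + card C * (1 + w) + card R * (1 + z) \<le> K"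
    and C_row: "card S * (w + 1) + (real (card C) - 1) * (2 * w) \<le> K * w"
    and R_row: "\<And>v. v \<in> R \<Longrightarrow> card S * (z + 1) + card (nbrs G v - S) * (2 * z) \<le> K * z"
  shows "q_radius G \<le> K"
proof -
  have fin: "finite S" "finite C" "finite R"
    using simple_graphD(1)[OF G] by (simp_all add: V)
  define c where "c = (\<lambda>v. if v \<in> S then 1 else if v \<in> C then w else z)"
  have cv: "\<forall>v\<in>S. c v = 1" "\<forall>v\<in>C. c v = w" "\<forall>v\<in>R. c v = z"
    using disj by (auto simp: c_def)
  note sums = full_nbrs_sum[where c = c, OF fin disj cv]
  have c_pos: "0 < c v" for v using wz by (simp add: c_def)
  have nn: "0 \<le> c v + c u" for u v using c_pos[of u] c_pos[of v] by simp
  have sep': "u \<in> S \<union> C" if "u \<in> nbrs G v" "v \<in> C" for u v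
    using that sep[of u v] V disj by (auto simp: nbrs_def adj_sym)
  have fin_full: "finite (full_nbrs S C R v)" for v by (rule finite_full_nbrs[OF fin])
  have sub: "nbrs G v \<subseteq> full_nbrs S C R v" if v: "v \<in> S \<union> C" for v
  proof
    fix u assume u: "u \<in> nbrs G v"
    then have "u \<noteq> v" "u \<in> verts G" using adjD[OF G, of v u] by (auto simp: nbrs_def)
    then show "u \<in> full_nbrs S C R v"
      using sep'[OF u] v V by (auto simp: full_nbrs_def)
  qed
  have le: "qop G c v \<le> (\<Sum>u\<in>full_nbrs S C R v. c v + c u)" if "v \<in> S \<union> C" for v
    unfolding qop_def by (rule sum_mono2[OF fin_full sub[OF that]]) (rule nn)
  have "qop G c v \<le> K * c v" if "v \<in> verts G" for v
  proof -
    consider "v \<in> S" | "v \<in> C" | "v \<in> R" using \<open>v \<in> verts G\<close> unfolding V by blast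
    then show ?thesis
    proof cases
      case 1
      then show ?thesis using le[of v] sums(1)[OF 1] S_row cv(1)[rule_format, OF 1] by simp
    next
      case 2
      then show ?thesis using le[of v] sums(2)[OF 2] C_row cv(2)[rule_format, OF 2] by simp
    next
      case 3
      note cvz = cv(3)[rule_format, OF 3]
      have finn: "finite (nbrs G v)" by (rule finite_nbrs[OF G])
      have "qop G c v = (\<Sum>u\<in>nbrs G v \<inter> S. c v + c u) + (\<Sum>u\<in>nbrs G v - S. c v + c u)"
        unfolding qop_def using sum.Int_Diff[OF finn] .
      also have "(\<Sum>u\<in>nbrs G v \<inter> S. c v + c u) \<le> (\<Sum>u\<in>S. c v + c u)"
        by (rule sum_mono2[OF fin(1)]) (auto simp: nn)
      also have "(\<Sum>u\<in>S. c v + c u) = card S * (z + 1)" by (simp add: cvz cv(1))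
      also have "(\<Sum>u\<in>nbrs G v - S. c v + c u) = (\<Sum>u\<in>nbrs G v - S. 2 * z)"
      proof (rule sum.cong)
        fix u assume "u \<in> nbrs G v - S"
        then have "u \<in> R" using sep[of v u] 3 by (auto simp: nbrs_def)
        then show "c v + c u = 2 * z" using cvz cv(3) by simp
      qed simp
      finally have "qop G c v \<le> card S * (z + 1) + card (nbrs G v - S) * (2 * z)" by simp
      then show ?thesis using R_row[OF 3] cvz by simp
    qed
  qed
  then show ?thesis by (rule collatz_wielandt(1)[OF G ne c_pos])
qed

section \<open>Graphs with a barrier\<close>

text \<open>\<open>C\<close> is a largest component of \<open>G - S\<close> and \<open>R\<close> the
  union of the others, of which there are at least \<open>k\<close>. A vertex of \<open>R\<close>
  has its neighbours outside \<open>S\<close> in its own component, which is no larger than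
  \<open>C\<close>.\<close>

lemma component_weights:
  assumes G: "simple_graph G" and S: "S \<subseteq> verts G" and T: "T \<subseteq> verts G - S" "k < card T"
    and sep: "\<And>x y. x \<in> T \<Longrightarrow> y \<in> T \<Longrightarrow> x \<noteq> y \<Longrightarrow>
      (x, y) \<notin> {(x, y). adj (delete_verts G S) x y}\<^sup>*"
    and deg: "\<And>v. v \<in> verts G \<Longrightarrow> d \<le> deg G v"
  obtains C R where "verts G = S \<union> C \<union> R" "S \<inter> C = {}" "S \<inter> R = {}" "C \<inter> R = {}" "C \<noteq> {}"
    "\<And>u v. adj G u v \<Longrightarrow> u \<in> R \<Longrightarrow> v \<in> S \<union> R"
    "k \<le> card R" "k * (d + 1 - card S) \<le> card R"
    "\<And>v. v \<in> R \<Longrightarrow> card (nbrs G v - S) < card C"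
    "\<And>v. v \<in> R \<Longrightarrow> card (nbrs G v - S) + k \<le> card R"
proof -
  let ?V = "verts G - S"
  let ?r = "{(x, y). adj (delete_verts G S) x y}"
  have fin: "finite ?V" using simple_graphD(1)[OF G] by simp
  have finS: "finite S" by (rule finite_subset[OF S simple_graphD(1)[OF G]])
  have sym: "sym (?r\<^sup>*)" by (rule sym_rtrancl) (auto simp: sym_def adj_sym)
  define comp where "comp = (\<lambda>v. {u. (v, u) \<in> ?r\<^sup>*})"
  have comp_eq: "comp u = comp v" if "(u, v) \<in> ?r\<^sup>*" for u v
    unfolding comp_def using that symD[OF sym that] by (auto intro: rtrancl_trans)
  have comp_refl: "v \<in> comp v" for v by (simp add: comp_def)
  have compV: "comp v \<subseteq> ?V" if "v \<in> ?V" for v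
  proof
    fix u assume "u \<in> comp v"
    then have "(v, u) \<in> ?r\<^sup>*" by (simp add: comp_def)
    then show "u \<in> ?V"
    proof (induction rule: rtrancl_induct)
      case (step y z)
      then show ?case using adjD(2)[OF G, of y z] by (simp add: adj_delete_verts)
    qed (rule that)
  qed
  have comp_nbr: "u \<in> comp v" if "adj G v u" "u \<notin> S" "v \<notin> S" for u v
    unfolding comp_def using that by (auto simp: adj_delete_verts)
  define P where "P = comp ` ?V"
  have finP: "finite P" using fin by (simp add: P_def)
  have P_sub: "A \<subseteq> ?V" if "A \<in> P" for A using that compV by (auto simp: P_def)
  have P_ne: "A \<noteq> {}" if "A \<in> P" for A using that comp_refl by (auto simp: P_def)
  have P_fin: "finite A" if "A \<in> P" for A by (rule finite_subset[OF P_sub[OF that] fin])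
  have P_comp: "comp v = A" if "A \<in> P" "v \<in> A" for A v
  proof -
    obtain x where x: "A = comp x" using \<open>A \<in> P\<close> by (auto simp: P_def)
    then have "(x, v) \<in> ?r\<^sup>*" using \<open>v \<in> A\<close> by (simp add: comp_def)
    then show ?thesis using comp_eq x by simp
  qed
  have P_disj: "A \<inter> B = {}" if "A \<in> P" "B \<in> P" "A \<noteq> B" for A B
    using P_comp[OF that(1)] P_comp[OF that(2)] that(3) by blast
  have UP: "\<Union>P = ?V"
  proof
    show "\<Union>P \<subseteq> ?V" using P_sub by blast
    show "?V \<subseteq> \<Union>P" using comp_refl by (auto simp: P_def)
  qed
  have "inj_on comp T"
  proof (rule inj_onI, rule ccontr)
    fix x y assume xy: "x \<in> T" "y \<in> T" "comp x = comp y" "x \<noteq> y"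
    then have "(x, y) \<in> ?r\<^sup>*" using comp_refl[of y] by (auto simp: comp_def)
    then show False using sep xy by blast
  qed
  then have "card T = card (comp ` T)" by (simp add: card_image)
  also have "\<dots> \<le> card P" using T(1) finP by (intro card_mono) (auto simp: P_def)
  finally have kP: "k < card P" using T(2) by simp
  have "P \<noteq> {}" using kP by auto
  then obtain C where C: "C \<in> P" "\<And>A. A \<in> P \<Longrightarrow> card A \<le> card C"
    using obtains_MAX[OF finP, of card] Max_ge[of "card ` P"] finP
    by (metis finite_imageI imageI)
  define R where "R = ?V - C"
  have R_Union: "R = \<Union>(P - {C})"
    unfolding R_def UP[symmetric] using P_disj[OF _ C(1)] by blast
  have cR: "card R = (\<Sum>A\<in>P - {C}. card A)"
    unfolding R_Union by (rule card_Union_disjoint) (auto simp: disjnt_def pairwise_def P_disj P_fin)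
  have kC: "k \<le> card (P - {C})" using kP C(1) finP by simp
  have nbC: "nbrs G v - S \<subseteq> comp v - {v}" if "v \<in> ?V" for v
    using that comp_nbr adjD(3)[OF G] by (fastforce simp: nbrs_def)
  have card_nb: "card (nbrs G v - S) < card (comp v)" if "v \<in> ?V" for v
  proof -
    have f: "finite (comp v)" by (rule finite_subset[OF compV[OF that] fin])
    have "card (nbrs G v - S) \<le> card (comp v - {v})"
      by (rule card_mono[OF _ nbC[OF that]]) (simp add: f)
    also have "\<dots> < card (comp v)" by (rule card_Diff1_less[OF f comp_refl])
    finally show ?thesis .
  qed
  \<comment> \<open>A vertex has at least \<open>d\<close> neighbours, at most \<open>card S\<close>
    of them in \<open>S\<close>; the rest and the vertex itself lie in one component.\<close>
  have comp_large: "d + 1 - card S \<le> card A" if A: "A \<in> P" for A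
  proof -
    obtain v where v: "v \<in> ?V" "A = comp v" using A by (auto simp: P_def)
    have "d \<le> card (nbrs G v)" using deg[of v] v(1) by (simp add: deg_def nbrs_def)
    also have "\<dots> \<le> card ((nbrs G v - S) \<union> S)"
      by (rule card_mono) (use finite_nbrs[OF G] finS in auto)
    also have "\<dots> \<le> card (nbrs G v - S) + card S" by (rule card_Un_le)
    finally show ?thesis using card_nb[OF v(1)] v(2) by simp
  qed
  have lower: "card Q \<le> (\<Sum>A\<in>Q. card A)" if "Q \<subseteq> P" for Q
  proof -
    have "(\<Sum>A\<in>Q. 1) \<le> (\<Sum>A\<in>Q. card A)"
    proof (rule sum_mono)
      fix A assume "A \<in> Q"
      then have "A \<in> P" using that by blast
      then show "1 \<le> card A" using P_ne P_fin by (simp add: Suc_le_eq card_gt_0_iff)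
    qed
    then show ?thesis by simp
  qed
  have R_comp: "comp v \<in> P - {C}" if "v \<in> R" for v
    using that comp_refl[of v] by (auto simp: R_def P_def)
  show ?thesis
  proof (rule that)
    show "verts G = S \<union> C \<union> R" using S P_sub[OF C(1)] by (auto simp: R_def)
    show "S \<inter> C = {}" using P_sub[OF C(1)] by blast
    show "S \<inter> R = {}" "C \<inter> R = {}" by (auto simp: R_def)
    show "C \<noteq> {}" by (rule P_ne[OF C(1)])
    show "v \<in> S \<union> R" if uv: "adj G u v" "u \<in> R" for u v
    proof (rule ccontr)
      assume n: "v \<notin> S \<union> R"
      then have "v \<in> C" using adjD(2)[OF G uv(1)] by (auto simp: R_def)
      then have "comp v = C" by (rule P_comp[OF C(1)])
      moreover have "v \<in> comp u" using comp_nbr[OF uv(1)] n uv(2) by (auto simp: R_def)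
      then have "comp u = comp v" using comp_eq by (simp add: comp_def)
      ultimately show False using R_comp[OF uv(2)] by simp
    qed
    show "k \<le> card R" using kC lower[of "P - {C}"] cR by simp
    have "k * (d + 1 - card S) \<le> card (P - {C}) * (d + 1 - card S)" using kC by simp
    also have "\<dots> = (\<Sum>A\<in>P - {C}. d + 1 - card S)" by simp
    also have "\<dots> \<le> card R" unfolding cR by (rule sum_mono) (use comp_large in auto)
    finally show "k * (d + 1 - card S) \<le> card R" .
    show "card (nbrs G v - S) < card C" if "v \<in> R" for v
    proof -
      have "v \<in> ?V" using that by (simp add: R_def)
      then show ?thesis using card_nb[of v] C(2)[of "comp v"] R_comp[OF that] by simp
    qed
    show "card (nbrs G v - S) + k \<le> card R" if "v \<in> R" for v
    proof -
      have v: "v \<in> ?V" using that by (simp add: R_def)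
      note Q = R_comp[OF that]
      \<comment> \<open>Besides the component of \<open>v\<close>, the set \<open>R\<close> contains
        at least \<open>k - 1\<close> nonempty ones, and \<open>v\<close> is not its own
        neighbour.\<close>
      have "card R = card (comp v) + (\<Sum>A\<in>P - {C} - {comp v}. card A)"
        unfolding cR by (rule sum.remove[OF _ Q]) (simp add: finP)
      moreover have "card (P - {C} - {comp v}) \<le> (\<Sum>A\<in>P - {C} - {comp v}. card A)"
        by (rule lower) blast
      moreover have "Suc (card (P - {C} - {comp v})) = card (P - {C})"
        by (rule card_Suc_Diff1[OF _ Q]) (simp add: finP)
      ultimately show ?thesis using kC card_nb[OF v] by linarith
    qed
  qed
qed

section \<open>The row inequalities for the weights, cleared of denominators\<close>

lemma S_row_arith:
  fixes b d n r s :: nat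
  assumes "2 \<le> b" "2 \<le> d" "2 \<le> s" "4 * b * d \<le> n" "b * d * d * d \<le> n + b * d + 2" "b * s \<le> r"
  shows "4 * (b * d * d) + 8 * (b * d) + 4 * s \<le> 4 * n + r * d"
proof -
  have r: "2 * s \<le> r" using mult_le_mono1[OF assms(1), of s] assms(6) by linarith
  show ?thesis
  proof (cases "d = 2")
    \<comment> \<open>For \<open>d = 2\<close> the bound \<open>4 * b * d\<close> on the order
      suffices; for larger \<open>d\<close> the cubic bound is the one that counts.\<close>
    case True
    then show ?thesis using r assms(4) by simp
  next
    case False
    then have d: "3 \<le> d" using assms(2) by simp
    have "r * 3 \<le> r * d" using d by simp
    moreover have "b * d * d * 3 \<le> b * d * d * d" "b * d * 3 \<le> b * d * d"
      using d by (intro mult_le_mono2; simp)+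
    moreover have "2 * 3 \<le> b * d" using mult_le_mono[OF assms(1) d] .
    ultimately show ?thesis using r assms(3,5) by linarith
  qed
qed

text \<open>For \<open>s\<close> up to \<open>d\<close>, the strict inequality
  \<open>b * d < r\<close> supplies the extra \<open>d\<close>; beyond that, \<open>b * s\<close>
  exceeds \<open>b * d\<close> by enough.\<close>

lemma C_row_arith:
  fixes b d r s :: nat
  assumes "2 \<le> b" "2 \<le> d" "b * s \<le> r" "b * d < r"
  shows "s + b * d * d \<le> r * d"
proof (cases "s \<le> d")
  case True
  have "(b * d + 1) * d \<le> r * d" using assms(4) by (intro mult_le_mono1) simp
  then show ?thesis using True by simp
next
  case False
  define t where "t = s - d"
  then have t: "s = d + t" "1 \<le> t" using False by simp_all
  have "b * s * d \<le> r * d" using assms(3) by (rule mult_le_mono1)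
  moreover have "b * s * d = b * d * d + b * (t * d)" by (simp add: t algebra_simps)
  moreover have "2 * (t * d) \<le> b * (t * d)" using assms(1) by (rule mult_le_mono1)
  moreover have "1 * d \<le> t * d" "t * 1 \<le> t * d" using t assms(2) by (intro mult_le_mono; simp)+
  ultimately show ?thesis using t by linarith
qed

text \<open>Here \<open>k\<close> stands for the number of neighbours outside \<open>S\<close>. The
  last assumption restricts \<open>b = d = 2\<close> to the small cases that these weights can
  handle.\<close>

lemma R_row_arith:
  fixes b d n s k :: nat
  assumes "2 \<le> b" "even b" "2 \<le> d" "2 \<le> s" "4 * b * d \<le> n" "2 * k + 1 + s + b * s \<le> n"
    and "b \<noteq> 2 \<or> d \<noteq> 2 \<or> n = 16 \<and> s \<le> 4"
  shows "s * (3 * d + 4) + 2 * (k * d) + 2 * (b * d * d) + 2 * d \<le> 2 * (n * d)"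
proof -
  have "(2 * k + 1 + s + b * s) * d \<le> n * d" "4 * b * d * d \<le> n * d"
    using assms(5,6) by (intro mult_le_mono1; simp)+
  then have nd: "2 * (k * d) + d + s * d + b * (s * d) \<le> n * d" "4 * (b * d * d) \<le> n * d"
    by (simp_all only: distrib_right mult.assoc mult_1_left)
  have sd: "s * 2 \<le> s * d" using assms(3) by (rule mult_le_mono2)
  have lhs: "s * (3 * d + 4) = 3 * (s * d) + 4 * s" by (simp add: algebra_simps)
  consider "4 \<le> b" | "b = 2" "3 \<le> d" | "b = 2" "d = 2" "n = 16" "s \<le> 4"
    using assms(1,2,3,7) by (cases "b = 3"; force)
  then show ?thesis
  proof cases
    case 1
    have "4 * (s * d) \<le> b * (s * d)" using 1 by (rule mult_le_mono1)
    moreover have "4 * d \<le> b * d" using 1 by (rule mult_le_mono1)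
    moreover have "b * d * 2 \<le> b * d * d" using assms(3) by (rule mult_le_mono2)
    ultimately show ?thesis using nd sd unfolding lhs by linarith
  next
    case 2
    have "3 * d \<le> d * d" using 2(2) by (rule mult_le_mono1)
    moreover have "n * 3 \<le> n * d" using 2(2) by (rule mult_le_mono2)
    ultimately show ?thesis using nd sd assms(6) unfolding lhs 2(1) mult.assoc by linarith
  next
    case 3
    then have "s = 2 \<or> s = 3 \<or> s = 4" using assms(4) by auto
    then show ?thesis using 3 assms(6) by auto
  qed
qed

text \<open>The extremal graph for \<open>b = d = 2\<close> and order \<open>16\<close>: the parts
  have sizes \<open>2\<close>, \<open>16 - 3 * 2\<close> and \<open>2 * 2\<close>.\<close>

lemma extremal_order_16: "45 / 2 < q_radius (extremal_graph 2 10 4)"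
proof -
  have "real 2 + 2 * (real 10 - 1) < 45 / 2" by simp
  moreover have "45 / 2 - 2 * (real 2 - 1) - real 10 - real 4 -
      real 10 * (real 2 / (45 / 2 - real 2 - 2 * (real 10 - 1))) -
      real 4 * (real 2 / (45 / 2 - real 2)) < 0"
    by (simp add: field_simps)
  ultimately obtain q w z :: real where "45 / 2 < q" and
    eqs: "0 < w" "2 * (real 2 - 1) + real 10 * (1 + w) + real 4 * (1 + z) = q"
    "real 2 * (w + 1) + (real 10 - 1) * (2 * w) = q * w" "real 2 * (z + 1) = q * z"
    by (rule extremal_root[of 2 10 "45 / 2" 4, rotated 2]) auto
  then show ?thesis using extremal_root_le_q_radius[OF _ eqs] by simp
qed

text \<open>The weights are \<open>1\<close> on \<open>S\<close>, \<open>d / (d + 2)\<close> on \<open>C\<close> and half of that on \<open>R\<close>. For \<open>b = d = 2\<close> they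
  fail when \<open>S\<close> is large, and \<open>R\<close> gets the weight \<open>1 / 3\<close>. For \<open>n = 16\<close> and \<open>card S = 5\<close>
  even \<open>2 (n - b d - 1) = 22\<close> is not an upper bound for \<open>q_radius G\<close>, and the value \<open>45 / 2\<close>
  separates the two spectral radii instead.\<close>

lemma barrier_q_radius:
  fixes b d :: nat
  assumes G: "simple_graph G" and b: "2 \<le> b" "even b" and d: "2 \<le> d"
    and n: "n = card (verts G)" "even n" "4 * b * d \<le> n" "b * d * d * d \<le> n + b * d + 2"
    and V: "verts G = S \<union> C \<union> R"
    and disj: "S \<inter> C = {}" "S \<inter> R = {}" "C \<inter> R = {}" and C: "C \<noteq> {}" and S: "2 \<le> card S"
    and sep: "\<And>u v. adj G u v \<Longrightarrow> u \<in> R \<Longrightarrow> v \<in> S \<union> R"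
    and R: "b * card S \<le> card R" "b * d < card R"
    and nbC: "\<And>v. v \<in> R \<Longrightarrow> card (nbrs G v - S) < card C"
    and nbR: "\<And>v. v \<in> R \<Longrightarrow> card (nbrs G v - S) + b * card S \<le> card R"
  shows "q_radius G < q_radius (extremal_graph d (n - (b + 1) * d) (b * d))"
proof -
  define s N r where "s = card S" and "N = card C" and "r = card R"
  have fin: "finite S" "finite C" "finite R"
    using simple_graphD(1)[OF G] by (simp_all add: V)
  have ne: "verts G \<noteq> {}" using C by (auto simp: V)
  have nN: "n = s + N + r"
    unfolding n(1) V s_def N_def r_def using fin disj
    by (subst card_Un_disjoint; (subst card_Un_disjoint)?) auto
  have N: "1 \<le> N" using C fin by (simp add: N_def Suc_le_eq card_gt_0_iff)
  note R' = R[folded s_def r_def] and S' = S[folded s_def]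
  \<comment> \<open>Sum of the bounds \<open>nbC\<close> and \<open>nbR\<close>.\<close>
  have nb: "2 * card (nbrs G v - S) + 1 + s + b * s \<le> n" if "v \<in> R" for v
    using nbC[OF that] nbR[OF that] unfolding nN s_def N_def r_def by linarith
  note bound = weighted_bound[OF G V disj ne sep, folded s_def N_def r_def]
  have bd: "2 * d \<le> b * d" using b by simp
  have "4 * (b * d) \<le> n" using n(3) by (simp only: mult.assoc)
  moreover have bdd: "(b + 1) * d = b * d + d" by (simp add: algebra_simps)
  ultimately have m: "(b + 1) * d + 1 \<le> n" using bd d by linarith
  define m' where "m' = n - (b + 1) * d"
  have m': "1 \<le> m'" "n = b * d + d + m'" using m bdd unfolding m'_def by linarith+
  have "1 \<le> d" "1 \<le> b * d" using d bd by linarith+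
  note gt = q_radius_extremal_graph_gt[OF this(1) m'(1) this(2)]
  \<comment> \<open>Since \<open>d + m' = n - b * d\<close>, the lower bound for the extremal graph
    becomes the target value \<open>K\<close>.\<close>
  have "real n - real (b * d) - 1 = real d + real m' - 1"
    unfolding m'(2) by (simp only: of_nat_add)
  then have gt: "2 * (real n - b * d - 1) < q_radius (extremal_graph d (n - (b + 1) * d) (b * d))"
    using gt unfolding m'_def[symmetric] by (simp only:)
  define K where "K = 2 * (real n - b * d - 1)"
  have real_le: "real x \<le> real y" if "x \<le> y" for x y using that by simp
  consider "b \<noteq> 2 \<or> d \<noteq> 2 \<or> n = 16 \<and> s \<le> 4" | "b = 2" "d = 2" "18 \<le> n"
    | "b = 2" "d = 2" "n = 16" "5 \<le> s"
  proof -
    have "n = 16 \<or> 18 \<le> n" if "b = 2" "d = 2"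
    proof -
      have "16 \<le> n" using n(3) that by simp
      moreover have "n \<noteq> 17" using n(2) by auto
      ultimately show ?thesis by linarith
    qed
    then show ?thesis using that by linarith
  qed
  then show ?thesis
  proof cases
    case generic: 1
    define w z where "w = real d / (d + 2)" and "z = real d / (2 * (d + 2))"
    have wd: "w * (d + 2) = d" and zd: "z * (2 * (d + 2)) = d"
      by (simp_all add: w_def z_def)
    have D: "0 < real d + 2" by simp
    have "q_radius G \<le> K"
    proof (rule bound)
      show "0 < w" "0 < z" using d by (simp_all add: w_def z_def)
      have 1: "real (4 * (b * d * d) + 8 * (b * d) + 4 * s) \<le> real (4 * n + r * d)"
        by (rule real_le[OF S_row_arith[OF b(1) d S' n(3,4) R'(1)]])
      \<comment> \<open>Multiplying by the denominator \<open>2 * (d + 2)\<close> turns the row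
        inequality into one between natural numbers.\<close>
      have "(K - (2 * (real s - 1) + N * (1 + w) + r * (1 + z))) * (2 * (d + 2)) =
          (K - (2 * (real s - 1) + N + r)) * (2 * (d + 2)) - 2 * N * (w * (d + 2)) -
            r * (z * (2 * (d + 2)))"
        by (simp add: algebra_simps)
      also have "\<dots> = real (4 * n + r * d) - real (4 * (b * d * d) + 8 * (b * d) + 4 * s)"
        unfolding wd zd by (simp add: K_def nN algebra_simps)
      also have "0 \<le> \<dots>" using 1 by simp
        finally have "0 \<le> (K - (2 * (real s - 1) + N * (1 + w) + r * (1 + z))) * (2 * (d + 2))" .
      then show "2 * (real s - 1) + N * (1 + w) + r * (1 + z) \<le> K"
        using D by (simp add: zero_le_mult_iff)
      have 2: "real (s + b * d * d) \<le> real (r * d)"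
        by (rule real_le[OF C_row_arith[OF b(1) d R']])
      have "(K * w - (s * (w + 1) + (real N - 1) * (2 * w))) * (d + 2) =
          (K - s - 2 * (real N - 1)) * (w * (d + 2)) - s * (d + 2)"
        by (simp add: algebra_simps)
      also have "\<dots> = 2 * (real (r * d) - real (s + b * d * d))"
        unfolding wd by (simp add: K_def nN algebra_simps)
      also have "0 \<le> \<dots>" using 2 by simp
        finally have "0 \<le> (K * w - (s * (w + 1) + (real N - 1) * (2 * w))) * (d + 2)" .
      then show "s * (w + 1) + (real N - 1) * (2 * w) \<le> K * w"
        using D by (simp add: zero_le_mult_iff)
      show "s * (z + 1) + card (nbrs G v - S) * (2 * z) \<le> K * z" if v: "v \<in> R" for v
      proof -
        define k where "k = card (nbrs G v - S)"
        have 3: "real (s * (3 * d + 4) + 2 * (k * d) + 2 * (b * d * d) + 2 * d) \<le> real (2 * (n * d))"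
          unfolding k_def by (rule real_le[OF R_row_arith[OF b d S' n(3) nb[OF v] generic]])
        have "(K * z - (s * (z + 1) + k * (2 * z))) * (2 * (d + 2)) =
            (K - s - 2 * k) * (z * (2 * (d + 2))) - s * (2 * (d + 2))"
          by (simp add: algebra_simps)
        also have "\<dots> = real (2 * (n * d)) -
            real (s * (3 * d + 4) + 2 * (k * d) + 2 * (b * d * d) + 2 * d)"
          unfolding zd by (simp add: K_def algebra_simps)
        also have "0 \<le> \<dots>" using 3 by simp
          finally have "0 \<le> (K * z - (s * (z + 1) + k * (2 * z))) * (2 * (d + 2))" .
        then have "s * (z + 1) + k * (2 * z) \<le> K * z"
          using D by (simp add: zero_le_mult_iff)
        then show ?thesis by (simp add: k_def)
      qed
    qed
    then show ?thesis using gt by (simp add: K_def)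
  next
    case 2
    note b2 = 2(1) and d2 = 2(2)
    have r: "2 * s \<le> r" "5 \<le> r" using R' b2 d2 by simp_all
    have Kn: "K = 2 * real n - 10" by (simp add: K_def b2 d2)
    have "q_radius G \<le> K"
    proof (rule bound)
      show "0 < (1 / 2 :: real)" "0 < (1 / 3 :: real)" by simp_all
      have "s + 48 \<le> 3 * n" using r(1) nN N 2(3) by linarith
      then have "real (s + 48) \<le> real (3 * n)" by (rule real_le)
      then show "2 * (real s - 1) + N * (1 + 1 / 2) + r * (1 + 1 / 3) \<le> K"
        using real_le[OF r(1)] by (simp add: Kn nN field_simps)
      \<comment> \<open>For \<open>s = 2\<close> this is exactly \<open>r >= 5\<close>, that is,
        \<open>b * d < r\<close>; for \<open>s >= 3\<close> it follows from
        \<open>2 * s <= r\<close>.\<close>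
      have "s + 8 \<le> 2 * r" using r S' by (cases "s = 2") auto
      then have "real (s + 8) \<le> real (2 * r)" by (rule real_le)
      then show "s * (1 / 2 + 1) + (real N - 1) * (2 * (1 / 2)) \<le> K * (1 / 2)"
        by (simp add: Kn nN field_simps)
      show "s * (1 / 3 + 1) + card (nbrs G v - S) * (2 * (1 / 3)) \<le> K * (1 / 3)"
        if v: "v \<in> R" for v
      proof -
        have "4 * s + 2 * card (nbrs G v - S) + 10 \<le> 2 * n"
          using nb[OF v] r(1) nN N 2(3) unfolding b2 by linarith
        then have "real (4 * s + 2 * card (nbrs G v - S) + 10) \<le> real (2 * n)" by (rule real_le)
        then show ?thesis by (simp add: Kn field_simps)
      qed
    qed
    then show ?thesis using gt by (simp add: K_def)
  next
    case 3
    note b2 = 3(1) and d2 = 3(2)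
    have "2 * s \<le> r" using R'(1) b2 by simp
    \<comment> \<open>Now \<open>G - S\<close> has no edges, and the common weight
      \<open>2 / 7\<close> solves \<open>5 * (z + 1) = 45 / 2 * z\<close>.\<close>
    then have vals: "s = 5" "N = 1" "r = 10" using 3 nN N by linarith+
    have "q_radius G \<le> 45 / 2"
    proof (rule bound)
      show "0 < (2 / 7 :: real)" "0 < (2 / 7 :: real)" by simp_all
      show "s * (2 / 7 + 1) + card (nbrs G v - S) * (2 * (2 / 7)) \<le> 45 / 2 * (2 / 7 :: real)"
        if v: "v \<in> R" for v
        using nbC[OF v, folded N_def] by (simp add: vals)
    qed (simp_all add: vals)
    then show ?thesis using extremal_order_16 by (simp add: 3)
  qed
qed

section \<open>Combining the barrier with the spectral bounds\<close>

theorem theorem1p2: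
  fixes G :: "'a graph" and b n \<delta> :: nat
  defines "H \<equiv> graph_join (complete_graph \<delta>)
                 (graph_union (complete_graph (n - (b + 1) * \<delta>))
                              (graph_copies (b * \<delta>) (complete_graph 1)))"
  assumes "b \<ge> 2" and "even b"
    and "simple_graph G"
    and "k_connected 2 G"
    and "n = card (verts G)" and "even n"
    and "\<delta> = min_degree G" and "\<delta> \<ge> 2"
    and "int n \<ge> max (4 * int b * int \<delta>) (int b * int \<delta> ^ 3 - int b * int \<delta> - 2)"
    and "q_radius G \<ge> q_radius H"
  shows "has_H_factor b G \<or> graph_iso G H"
proof (cases "has_H_factor b G")
  case no: False
  note b = assms(2,3) and G = assms(4) and d = assms(9)
  interpret even_bound b by unfold_locales (use b in auto)
  have two: "connected_graph (delete_verts G X)" if "X \<subseteq> verts G" "card X < 2" for X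
    using assms(5) that by (simp add: k_connected_def)
  have conn: "connected_graph G" using two[of "{}"] by (simp add: delete_verts_empty)
  have fin: "finite (verts G)" by (rule simple_graphD(1)[OF G])
  have deg: "\<delta> \<le> deg G v" if "v \<in> verts G" for v
    unfolding assms(8) min_degree_def using fin that by (intro Min_le) auto
  have ev: "even (card (verts G))" using assms(6,7) by simp
  obtain S T where S: "S \<subseteq> verts G" "S \<noteq> {}" and T: "T \<subseteq> verts G - S" "b * card S < card T"
    and sep: "\<And>x y. x \<in> T \<Longrightarrow> y \<in> T \<Longrightarrow> x \<noteq> y \<Longrightarrow>
      (x, y) \<notin> {(x, y). adj (delete_verts G S) x y}\<^sup>*"
    using H_factor_or_barrier[OF G conn ev no] by metis
  have finS: "finite S" by (rule finite_subset[OF S(1) fin])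
  have S_pos: "1 \<le> card S" using S(2) finS by (simp add: Suc_le_eq card_gt_0_iff)
  \<comment> \<open>Deleting a single vertex keeps \<open>G\<close> connected, whereas
    \<open>T\<close> contains at least two mutually unreachable vertices.\<close>
  have S2: "2 \<le> card S"
  proof (rule ccontr)
    assume "\<not> 2 \<le> card S"
    then have "connected_graph (delete_verts G S)" using two[OF S(1)] by simp
    then have all: "(x, y) \<in> {(x, y). adj (delete_verts G S) x y}\<^sup>*" if "x \<in> T" "y \<in> T" for x y
      using that T(1) unfolding connected_graph_def by auto
    have "b * 1 \<le> b * card S" using S_pos by (rule mult_le_mono2)
    then have "1 < card T" using T(2) b(1) by linarith
    then obtain x y where "x \<in> T" "y \<in> T" "x \<noteq> y"
      using card_le_Suc0_iff_eq[OF card_ge_0_finite, of T] by fastforce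
    then show False using all sep by blast
  qed
  obtain C R where V: "verts G = S \<union> C \<union> R"
    and disj: "S \<inter> C = {}" "S \<inter> R = {}" "C \<inter> R = {}" and C: "C \<noteq> {}"
    and sepR: "\<And>u v. adj G u v \<Longrightarrow> u \<in> R \<Longrightarrow> v \<in> S \<union> R"
    and R: "b * card S \<le> card R" "b * card S * (\<delta> + 1 - card S) \<le> card R"
    and nbC: "\<And>v. v \<in> R \<Longrightarrow> card (nbrs G v - S) < card C"
    and nbR: "\<And>v. v \<in> R \<Longrightarrow> card (nbrs G v - S) + b * card S \<le> card R"
    by (rule component_weights[OF G S(1) T sep deg]) blast+
  have n1: "4 * b * \<delta> \<le> n"
  proof -
    have "int (4 * b * \<delta>) \<le> int n" using assms(10) by simp
    then show ?thesis by linarith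
  qed
  have n2: "b * \<delta> * \<delta> * \<delta> \<le> n + b * \<delta> + 2"
  proof -
    have "int (b * \<delta> * \<delta> * \<delta>) \<le> int (n + b * \<delta> + 2)"
      using assms(10) by (simp add: power3_eq_cube mult.assoc)
    then show ?thesis by linarith
  qed
  have le: "card R \<le> b * \<delta>"
  proof (rule ccontr)
    assume "\<not> card R \<le> b * \<delta>"
    then have "b * \<delta> < card R" by simp
    from barrier_q_radius[OF G b d assms(6,7) n1 n2 V disj C S2 sepR R(1) this nbC nbR]
    show False using assms(11) unfolding H_def by simp
  qed
  \<comment> \<open>The component sizes give \<open>s * (t + 1) <= s + t\<close> for
    \<open>s = card S\<close> and \<open>t\<close> the gap to the minimum degree, hence
    \<open>s * t <= t\<close>, which is impossible for \<open>s >= 2\<close> and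
    \<open>t >= 1\<close>.\<close>
  have s: "card S = \<delta>"
  proof (rule ccontr)
    assume "card S \<noteq> \<delta>"
    moreover have "b * card S \<le> b * \<delta>" using R(1) le by (rule le_trans)
    then have "card S \<le> \<delta>" using b(1) by simp
    ultimately have lt: "card S < \<delta>" by simp
    define t where "t = \<delta> - card S"
    then have t: "\<delta> = card S + t" "1 \<le> t" using lt by simp_all
    have sub: "\<delta> + 1 - card S = t + 1" using t by simp
    have "b * card S * (t + 1) \<le> b * \<delta>" using R(2) le unfolding sub by (rule le_trans)
    then have "b * (card S * (t + 1)) \<le> b * (card S + t)"
      unfolding mult.assoc by (simp only: t(1)[symmetric])
    then have "card S * (t + 1) \<le> card S + t" using b(1) by (simp only: mult_le_cancel1)
    then have "card S * t \<le> t" by simp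
    moreover have "2 * t \<le> card S * t" using S2 by (rule mult_le_mono1)
    ultimately show False using t by simp
  qed
  then have r: "card R = b * \<delta>" using R(1) le by simp
  have finV: "finite C" "finite R" using fin V by simp_all
  have "n = card S + card C + card R"
    unfolding assms(6) V using finS finV disj
    by (subst card_Un_disjoint; (subst card_Un_disjoint)?) auto
  then have c: "card C = n - (b + 1) * \<delta>" using s r by simp
  have "1 \<le> card C" using C finV by (simp add: Suc_le_eq card_gt_0_iff)
  \<comment> \<open>As \<open>card R = b * card S\<close>, the bound \<open>nbR\<close> leaves no
    neighbours outside \<open>S\<close>, so \<open>R\<close> is independent.\<close>
  moreover have "v \<in> S" if "adj G u v" "u \<in> R" for u v
  proof -
    have "card (nbrs G u - S) = 0" using nbR[OF that(2)] s r by simp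
    then have "nbrs G u \<subseteq> S" using finite_nbrs[OF G, of u] by simp
    then show ?thesis using that(1) adjD(2)[OF G that(1)] by (auto simp: nbrs_def)
  qed
  ultimately have "graph_iso G H"
    unfolding H_def
    using d b assms(11)[unfolded H_def] c s r
    by (intro extremal_case[OF G conn _ V disj]) auto
  then show ?thesis ..
qed simp

end
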